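(* For $n=1,3,7$ one has $\mathbf{TC}(\mathbf{RP}^n)=n+1$.
   Context: For a connected CW complex $X$, let $PX$ be the space of all continuous paths $\gamma:[0,1]\to X$ with the compact-open topology, and let $\pi:PX\to X\times X$, $\pi(\gamma)=(\gamma(0),\gamma(1))$. The topological complexity $\mathbf{TC}(X)$ is the smallest number $k$ such that $X\times X$ can be covered by open sets $U_1,\dots,U_k$ so that for every $i=1,\dots,k$ there exists a continuous map $s_i:U_i\to PX$ with $\pi\circ s_i=\mathrm{id}_{U_i}$. $\mathbf{RP}^n$ denotes the real projective space of dimension $n$. *)

theory Defs
  imports "HOL-Analysis.Analysis"
begin

definition quotient_topology :: "'a topology \<Rightarrow> ('a \<Rightarrow> 'b) \<Rightarrow> 'b topology" where
  "quotient_topology X q =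
     topology (\<lambda>U. U \<subseteq> q ` topspace X \<and> openin X {x \<in> topspace X. q x \<in> U})"

lemma istopology_quotient_topology:
  "istopology (\<lambda>U. U \<subseteq> q ` topspace X \<and> openin X {x \<in> topspace X. q x \<in> U})"
  unfolding istopology_def
proof (intro conjI allI impI)
  fix S T
  assume ST: "S \<subseteq> q ` topspace X \<and> openin X {x \<in> topspace X. q x \<in> S}"
             "T \<subseteq> q ` topspace X \<and> openin X {x \<in> topspace X. q x \<in> T}"
  have "{x \<in> topspace X. q x \<in> S \<inter> T}
        = {x \<in> topspace X. q x \<in> S} \<inter> {x \<in> topspace X. q x \<in> T}"
    by blast
  with ST show "openin X {x \<in> topspace X. q x \<in> S \<inter> T}"
    by (simp add: openin_Int)
  from ST show "S \<inter> T \<subseteq> q ` topspace X"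
    by blast
next
  fix \<K>
  assume K: "\<forall>K\<in>\<K>. K \<subseteq> q ` topspace X \<and> openin X {x \<in> topspace X. q x \<in> K}"
  have "{x \<in> topspace X. q x \<in> \<Union>\<K>} = (\<Union>K\<in>\<K>. {x \<in> topspace X. q x \<in> K})"
    by blast
  moreover have "openin X (\<Union>K\<in>\<K>. {x \<in> topspace X. q x \<in> K})"
    using K by (intro openin_Union) auto
  ultimately show "openin X {x \<in> topspace X. q x \<in> \<Union>\<K>}"
    by simp
  from K show "\<Union>\<K> \<subseteq> q ` topspace X"
    by blast
qed

lemma openin_quotient_topology:
  "openin (quotient_topology X q) U \<longleftrightarrow>
     U \<subseteq> q ` topspace X \<and> openin X {x \<in> topspace X. q x \<in> U}"
  unfolding quotient_topology_def topology_inverse'[OF istopology_quotient_topology] ..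

lemma topspace_quotient_topology: "topspace (quotient_topology X q) = q ` topspace X"
proof (rule antisym)
  show "topspace (quotient_topology X q) \<subseteq> q ` topspace X"
    using openin_quotient_topology[THEN iffD1, OF openin_topspace] by (rule conjunct1)
  have "{x \<in> topspace X. q x \<in> q ` topspace X} = topspace X"
    by blast
  then have "openin (quotient_topology X q) (q ` topspace X)"
    by (simp add: openin_quotient_topology)
  then show "q ` topspace X \<subseteq> topspace (quotient_topology X q)"
    by (rule openin_subset)
qed

lemma quotient_map_quotient_topology: "quotient_map X (quotient_topology X q) q"
  by (auto simp: quotient_map_def topspace_quotient_topology openin_quotient_topology)

text \<open>The sphere \<^term>\<open>nsphere n\<close> is the unit sphere of dimension \<open>n\<close>, sitting in the
  \<open>Suc n\<close>-dimensional Euclidean space. A point of the projective space is an antipodal pair.\<close>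

definition real_projective_space :: "nat \<Rightarrow> (nat \<Rightarrow> real) set topology" where
  "real_projective_space n = quotient_topology (nsphere n) (\<lambda>x. {x, (\<lambda>i. - x i)})"

text \<open>HOL functions are total, so maps out of \<open>X\<close> are represented by functions that are
  undefined outside the underlying set of \<open>X\<close>; equality is then agreement on that set.\<close>

definition compact_open_topology :: "'a topology \<Rightarrow> 'b topology \<Rightarrow> ('a \<Rightarrow> 'b) topology" where
  "compact_open_topology X Y =
     topology_generated_by
       {{f \<in> extensional (topspace X). continuous_map X Y f \<and> f ` K \<subseteq> U} | K U.
          compactin X K \<and> openin Y U}"

lemma topspace_compact_open_topology:
  "topspace (compact_open_topology X Y) = {f \<in> extensional (topspace X). continuous_map X Y f}"
proof (rule antisym)
  show "topspace (compact_open_topology X Y) \<subseteq> {f \<in> extensional (topspace X). continuous_map X Y f}"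
    unfolding compact_open_topology_def topology_generated_by_topspace by blast
  have "{f \<in> extensional (topspace X). continuous_map X Y f}
        = {f \<in> extensional (topspace X). continuous_map X Y f \<and> f ` {} \<subseteq> {}}"
    by simp
  also have "\<dots> \<in> {{f \<in> extensional (topspace X). continuous_map X Y f \<and> f ` K \<subseteq> U} | K U.
                    compactin X K \<and> openin Y U}"
    using compactin_empty openin_empty by blast
  finally show "{f \<in> extensional (topspace X). continuous_map X Y f} \<subseteq> topspace (compact_open_topology X Y)"
    unfolding compact_open_topology_def topology_generated_by_topspace by (rule Union_upper)
qed

definition path_space :: "'a topology \<Rightarrow> (real \<Rightarrow> 'a) topology" where
  "path_space X = compact_open_topology (top_of_set {0..1}) X"

definition path_endpoints :: "(real \<Rightarrow> 'a) \<Rightarrow> 'a \<times> 'a" where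
  "path_endpoints \<gamma> = (\<gamma> 0, \<gamma> 1)"

definition has_motion_planner_cover :: "'a topology \<Rightarrow> nat \<Rightarrow> bool" where
  "has_motion_planner_cover X k \<longleftrightarrow>
     (\<exists>U :: nat \<Rightarrow> ('a \<times> 'a) set.
        (\<forall>i\<in>{1..k}. openin (prod_topology X X) (U i)) \<and>
        (\<Union>i\<in>{1..k}. U i) = topspace (prod_topology X X) \<and>
        (\<forall>i\<in>{1..k}. \<exists>s. continuous_map (subtopology (prod_topology X X) (U i)) (path_space X) s \<and>
                          (\<forall>p\<in>U i. path_endpoints (s p) = p)))"

text \<open>The value is \<open>\<infinity>\<close> if no finite cover of this kind exists.\<close>

definition topological_complexity :: "'a topology \<Rightarrow> enat" where
  "topological_complexity X = Inf {enat k | k. has_motion_planner_cover X k}"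

lemma topological_complexity_eq_enat_iff:
  "topological_complexity X = enat k \<longleftrightarrow>
     has_motion_planner_cover X k \<and> (\<forall>j<k. \<not> has_motion_planner_cover X j)"
  (is "?L \<longleftrightarrow> ?R")
proof
  define A where "A = {enat k | k. has_motion_planner_cover X k}"
  have TC: "topological_complexity X = Inf A"
    by (simp add: A_def topological_complexity_def)
  {
    assume eq: ?L
    then have "A \<noteq> {}"
      unfolding TC by (auto simp: Inf_enat_def)
    then obtain a where "a \<in> A"
      by blast
    then have "(LEAST x. x \<in> A) \<in> A"
      by (rule LeastI)
    with \<open>A \<noteq> {}\<close> have "enat k \<in> A"
      using eq unfolding TC by (simp add: Inf_enat_def)
    moreover have "k \<le> j" if "has_motion_planner_cover X j" for j
    proof -
      have "Inf A \<le> enat j"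
        using that by (intro Inf_lower) (auto simp: A_def)
      with eq show ?thesis
        by (simp add: TC)
    qed
    ultimately show ?R
      by (auto simp: A_def not_le[symmetric])
  next
    assume R: ?R
    have "Inf A = enat k"
    proof (rule antisym)
      show "Inf A \<le> enat k"
        using R by (intro Inf_lower) (auto simp: A_def)
      show "enat k \<le> Inf A"
      proof (rule Inf_greatest)
        fix a assume "a \<in> A"
        then obtain j where "a = enat j" "has_motion_planner_cover X j"
          by (auto simp: A_def)
        with R show "enat k \<le> a"
          by (meson enat_ord_simps(1) not_le)
      qed
    qed
    then show ?L
      by (simp add: TC)
  }
qed

end

theory Submission
  imports Defs "HOL-Homology.Invariance_of_Domain"
begin

text \<open>
  The upper bound comes from the multiplication of complex numbers, quaternions and octonions.
  It provides, for every unit vector \<open>x\<close>, an orthonormal basis \<open>A\<^sub>0 x = x, A\<^sub>1 x, \<dots>, A\<^sub>n x\<close> that depends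
  linearly on \<open>x\<close>. If \<open>y\<close> is not orthogonal to \<open>A\<^sub>i x\<close>, then the line of \<open>x\<close> can be moved to the line of
  \<open>y\<close> along a curve bent towards \<open>A\<^sub>i x\<close> without any further choice, so each \<open>i\<close> yields a motion planner on an
  open set of pairs of lines. The \<open>n + 1\<close> sets cover everything since the \<open>A\<^sub>i x\<close> form a basis.

  The lower bound holds in all dimensions, by a Lusternik-Schnirelmann argument. A motion planner
  restricted to motions that start at a fixed line selects, for the end lines in an open
  set \<open>V\<close>, a path to the base line, and transport along that path singles out one of the two unit
  vectors on each line in \<open>V\<close>. This is an odd nowhere vanishing function on the preimage of \<open>V\<close> in the
  sphere. A cover by \<open>k\<close> such sets thus produces \<open>k\<close> odd functions on the \<open>n\<close>-sphere without common
  zero, and \<open>k \<le> n\<close> contradicts the Borsuk-Ulam theorem.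

  The Borsuk-Ulam theorem follows from the oddness of the degree of an odd map, which is proved by
  induction on the dimension: such a map is deformed until it preserves the equator, and the
  restriction to the equator has degree of the same parity
  (\<open>Borsuk_odd_mapping_degree_step\<close>). The main lemmas are \<open>odd_map_odd_degree\<close>,
  \<open>odd_function_of_local_section\<close> and \<open>motion_planner_cover_of_vector_fields\<close>.
\<close>

section \<open>Spheres and radial projection\<close>

lemma mem_nsphere_iff:
  "x \<in> topspace (nsphere n) \<longleftrightarrow> (\<Sum>i\<le>n. (x i)\<^sup>2) = 1 \<and> (\<forall>i>n. x i = 0)"
  by (simp add: nsphere)

text \<open>This turns statements about the abstract space \<^term>\<open>nsphere n\<close> into statements about
\<open>continuous_on\<close>, \<open>compact\<close> and the metric of \<^typ>\<open>nat \<Rightarrow> real\<close>.\<close>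

lemma nsphere_eq_top_of_set: "nsphere n = top_of_set (topspace (nsphere n))"
  by (simp add: nsphere flip: euclidean_product_topology)

lemma compact_nsphere: "compact (topspace (nsphere n))"
proof -
  let ?K = "\<lambda>i::nat. if i \<le> n then {-1..1::real} else {0}"
  have "topspace (nsphere n) \<subseteq> PiE UNIV ?K"
  proof
    fix x assume x: "x \<in> topspace (nsphere n)"
    have "x i \<in> ?K i" for i
      using topspace_nsphere_1[OF x, of i] x by (auto simp: mem_nsphere_iff abs_square_le_1 abs_le_iff)
    then show "x \<in> PiE UNIV ?K"
      by (simp add: PiE_UNIV_domain)
  qed
  moreover have "compact (PiE UNIV ?K)"
  proof -
    have "compactin (product_topology (\<lambda>i::nat. euclideanreal) UNIV) (PiE UNIV ?K)"
      by (subst compactin_PiE) auto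
    then show ?thesis
      by (simp add: euclidean_product_topology)
  qed
  moreover have "closed (topspace (nsphere n))"
  proof -
    have *: "topspace (nsphere n) = {x. (\<Sum>i\<le>n. (x i)\<^sup>2) = 1} \<inter> (\<Inter>i\<in>{n<..}. {x. x i = 0})"
      by (auto simp: mem_nsphere_iff)
    have "closed {x :: nat \<Rightarrow> real. (\<Sum>i\<le>n. (x i)\<^sup>2) = 1}"
      by (intro closed_Collect_eq continuous_intros continuous_on_product_coordinates)
    moreover have "closed (\<Inter>i\<in>{n<..}. {x :: nat \<Rightarrow> real. x i = 0})"
      by (intro closed_INT ballI closed_Collect_eq continuous_on_product_coordinates continuous_on_const)
    ultimately show ?thesis
      unfolding * by (rule closed_Int)
  qed
  ultimately show ?thesis
    by (metis compact_Int_closed inf.absorb_iff2)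
qed

definition antipode :: "(nat \<Rightarrow> real) \<Rightarrow> nat \<Rightarrow> real" where
  "antipode x = (\<lambda>i. - x i)"

lemma antipode_apply [simp]: "antipode x i = - x i"
  by (simp add: antipode_def)

lemma antipode_antipode [simp]: "antipode (antipode x) = x"
  by (simp add: antipode_def)

lemma antipode_mem_nsphere [simp]: "antipode x \<in> topspace (nsphere n) \<longleftrightarrow> x \<in> topspace (nsphere n)"
  by (simp add: mem_nsphere_iff)

lemma continuous_map_into_nsphere_iff:
  "continuous_map X (nsphere n) f \<longleftrightarrow>
     (\<forall>i. continuous_map X euclideanreal (\<lambda>x. f x i)) \<and> f ` topspace X \<subseteq> topspace (nsphere n)"
  by (auto simp: nsphere continuous_map_in_subtopology continuous_map_componentwise_UNIV)

lemma continuous_map_antipode: "continuous_map (nsphere n) (nsphere n) antipode"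
  by (auto simp: continuous_map_into_nsphere_iff continuous_map_nsphere_projection
      intro!: continuous_map_minus)

text \<open>Maps into the sphere are written below as arbitrary nowhere vanishing maps followed by radial
projection. Coordinates above \<open>n\<close> are reset to \<open>0\<close>, so only the first \<open>n + 1\<close> coordinates of
the argument matter.\<close>

definition normalize_to_sphere :: "nat \<Rightarrow> (nat \<Rightarrow> real) \<Rightarrow> nat \<Rightarrow> real" where
  "normalize_to_sphere n x = (\<lambda>i. if i \<le> n then x i / sqrt (\<Sum>j\<le>n. (x j)\<^sup>2) else 0)"

lemma sum_squares_pos:
  fixes x :: "nat \<Rightarrow> real"
  assumes "i \<le> n" "x i \<noteq> 0"
  shows "0 < (\<Sum>j\<le>n. (x j)\<^sup>2)"
  by (rule sum_pos2[where i=i]) (use assms in auto)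

lemma normalize_to_sphere_mem:
  assumes "i \<le> n" "x i \<noteq> 0"
  shows "normalize_to_sphere n x \<in> topspace (nsphere n)"
proof -
  have "0 < (\<Sum>j\<le>n. (x j)\<^sup>2)"
    using assms by (rule sum_squares_pos)
  then have "(\<Sum>i\<le>n. (x i / sqrt (\<Sum>j\<le>n. (x j)\<^sup>2))\<^sup>2) = 1"
    by (simp add: power_divide flip: sum_divide_distrib)
  then show ?thesis
    by (simp add: mem_nsphere_iff normalize_to_sphere_def)
qed

lemma normalize_to_sphere_id:
  "x \<in> topspace (nsphere n) \<Longrightarrow> normalize_to_sphere n x = x"
  by (auto simp: mem_nsphere_iff normalize_to_sphere_def)

lemma normalize_to_sphere_scale:
  assumes "c > 0"
  shows "normalize_to_sphere n (\<lambda>i. c * x i) = normalize_to_sphere n x"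
  using assms
  by (auto simp: normalize_to_sphere_def power_mult_distrib real_sqrt_mult simp flip: sum_distrib_left)

lemma normalize_to_sphere_antipode:
  "normalize_to_sphere n (antipode x) = antipode (normalize_to_sphere n x)"
  by (auto simp: normalize_to_sphere_def)

lemma continuous_map_normalize_to_sphere:
  assumes "\<And>i. i \<le> n \<Longrightarrow> continuous_map X euclideanreal (\<lambda>x. f x i)"
    and "\<And>x. x \<in> topspace X \<Longrightarrow> \<exists>i\<le>n. f x i \<noteq> 0"
  shows "continuous_map X (nsphere n) (\<lambda>x. normalize_to_sphere n (f x))"
  unfolding continuous_map_into_nsphere_iff
proof (intro conjI allI)
  have pos: "0 < (\<Sum>j\<le>n. (f x j)\<^sup>2)" if "x \<in> topspace X" for x
    using assms(2)[OF that] sum_squares_pos by blast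
  fix i
  show "continuous_map X euclideanreal (\<lambda>x. normalize_to_sphere n (f x) i)"
  proof (cases "i \<le> n")
    case True
    then show ?thesis
      unfolding normalize_to_sphere_def
      by (auto intro!: continuous_intros assms(1) dest: pos)
  qed (simp add: normalize_to_sphere_def)
next
  show "(\<lambda>x. normalize_to_sphere n (f x)) ` topspace X \<subseteq> topspace (nsphere n)"
    using assms(2) normalize_to_sphere_mem by blast
qed

text \<open>Straight-line homotopy in the ambient space, pushed back to the sphere.\<close>

lemma homotopic_normalize_to_sphere:
  assumes f: "\<And>i. i \<le> n \<Longrightarrow> continuous_map X euclideanreal (\<lambda>x. f x i)"
    and g: "\<And>i. i \<le> n \<Longrightarrow> continuous_map X euclideanreal (\<lambda>x. g x i)"
    and nz: "\<And>x t. \<lbrakk>x \<in> topspace X; 0 \<le> t; t \<le> 1\<rbrakk> \<Longrightarrow> \<exists>i\<le>n. (1 - t) * f x i + t * g x i \<noteq> 0"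
  shows "homotopic_with (\<lambda>_. True) X (nsphere n)
           (\<lambda>x. normalize_to_sphere n (f x)) (\<lambda>x. normalize_to_sphere n (g x))"
proof -
  let ?h = "\<lambda>z. normalize_to_sphere n (\<lambda>i. (1 - fst z) * f (snd z) i + fst z * g (snd z) i)"
  have "continuous_map (prod_topology (top_of_set {0..1}) X) (nsphere n) ?h"
  proof (rule continuous_map_normalize_to_sphere)
    fix i assume i: "i \<le> n"
    have fst: "continuous_map (prod_topology (top_of_set {0..1}) X) euclideanreal fst"
      by (metis continuous_map_fst continuous_map_into_fulltopology)
    have snd: "continuous_map (prod_topology (top_of_set {0..1::real}) X) X snd"
      by (rule continuous_map_snd)
    show "continuous_map (prod_topology (top_of_set {0..1}) X) euclideanreal
            (\<lambda>z. (1 - fst z) * f (snd z) i + fst z * g (snd z) i)"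
      using continuous_map_compose[OF snd f[OF i]] continuous_map_compose[OF snd g[OF i]] fst
      by (intro continuous_intros) (auto simp: o_def)
  qed (use nz in auto)
  then show ?thesis
    unfolding homotopic_with_def
    by (intro exI[of _ ?h]) (auto simp: continuous_map_normalize_to_sphere)
qed

section \<open>Odd maps have odd degree\<close>

text \<open>A continuous map of spheres may well be surjective on the equator. A smooth one is not, because a
smooth image of a lower-dimensional sphere has measure zero. Approximating \<open>f\<close> by a polynomial map
\<open>p\<close> and passing to \<open>p v - p (- v)\<close> makes the approximation odd, and since the result has distance less than \<open>2\<close>
from \<open>2 f\<close>, a vector of length \<open>2\<close>, it always has positive inner product with \<open>f\<close>, so that the straight-line homotopy never
meets the origin. Polynomial approximation and measure zero live in a Euclidean space, which
enters through the type \<^typ>\<open>'a\<close>: the sphere is embedded by means of the first \<open>n + 1\<close>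
vectors of an orthonormal basis.\<close>

lemma odd_map_homotopic_missing_point:
  assumes n: "n < DIM('a::euclidean_space)" "0 < n"
    and f: "continuous_map (nsphere n) (nsphere n) f"
    and odd: "\<And>x. x \<in> topspace (nsphere n) \<Longrightarrow> f (antipode x) = antipode (f x)"
  obtains g v where "continuous_map (nsphere n) (nsphere n) g"
    and "\<And>x. x \<in> topspace (nsphere n) \<Longrightarrow> g (antipode x) = antipode (g x)"
    and "homotopic_with (\<lambda>_. True) (nsphere n) (nsphere n) f g"
    and "v \<in> topspace (nsphere n)" "v \<notin> g ` topspace (nsphere (n - 1))"
proof -
  obtain b :: "nat \<Rightarrow> 'a" where b: "bij_betw b {..<DIM('a)} Basis"
    by (metis finite_Basis ex_bij_betw_nat_finite lessThan_atLeast0)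
  have bB: "b i \<in> Basis" if "i \<le> n" for i
    using b n that by (auto simp: bij_betw_def)
  have inj: "inj_on b {..n}"
    using b n by (auto simp: bij_betw_def intro: inj_on_subset)
  have bb: "b i \<bullet> b j = (if i = j then 1 else 0)" if "i \<le> n" "j \<le> n" for i j
    using that bB inj by (auto simp: inner_Basis inj_on_def)
  define emb :: "(nat \<Rightarrow> real) \<Rightarrow> 'a" where "emb = (\<lambda>x. \<Sum>i\<le>n. x i *\<^sub>R b i)"
  define co :: "'a \<Rightarrow> nat \<Rightarrow> real" where "co = (\<lambda>v i. if i \<le> n then v \<bullet> b i else 0)"
  define T where "T = span (b ` {..n})"
  define S where "S = span (b ` {..<n})"
  define K where "K = sphere 0 1 \<inter> T"
  have emb_b: "emb x \<bullet> b i = x i" if "i \<le> n" for x i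
    using that by (simp add: emb_def inner_sum_left bb if_distrib cong: if_cong)
  have co_emb: "co (emb x) = (\<lambda>i. if i \<le> n then x i else 0)" for x
    by (auto simp: co_def emb_b)
  have inner_emb: "emb x \<bullet> emb y = (\<Sum>i\<le>n. x i * y i)" for x y
    by (subst (2) emb_def) (simp add: inner_sum_right emb_b mult.commute)
  have norm_emb: "norm (emb x) = sqrt (\<Sum>i\<le>n. (x i)\<^sup>2)" for x
    by (simp add: norm_eq_sqrt_inner inner_emb power2_eq_square)
  have emb_T: "emb x \<in> T" for x
    unfolding emb_def T_def by (intro span_sum span_scale span_base) auto
  have emb_co: "emb (co v) = v" if "v \<in> T" for v
    using that unfolding T_def
  proof (induction rule: span_induct_alt)
    case base
    show ?case by (simp add: emb_def co_def)
  next
    case (step c x y)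
    then obtain j where j: "j \<le> n" "x = b j" by auto
    have "emb (co (c *\<^sub>R x + y)) = c *\<^sub>R emb (co x) + emb (co y)"
      by (simp add: emb_def co_def inner_add_left scaleR_add_left sum.distrib scaleR_sum_right)
    moreover have "emb (co x) = x"
      using j by (simp add: emb_def co_def bb if_distrib[of "\<lambda>c. c *\<^sub>R _"] cong: if_cong)
    ultimately show ?case
      using step by simp
  qed
  have emb_neg: "emb (antipode x) = - emb x" for x
    by (simp add: emb_def sum_negf)
  have co_neg: "co (- v) = antipode (co v)" for v
    by (auto simp: co_def)
  have emb_K: "emb x \<in> K" if "x \<in> topspace (nsphere n)" for x
    using that by (simp add: K_def emb_T norm_emb mem_nsphere_iff)
  have co_K: "co v \<in> topspace (nsphere n)" if "v \<in> K" for v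
  proof -
    have "emb (co v) = v" "norm v = 1"
      using that by (auto simp: K_def emb_co)
    then show ?thesis
      by (metis co_def mem_nsphere_iff norm_emb not_le real_sqrt_eq_1_iff)
  qed
  have K_neg: "- v \<in> K" if "v \<in> K" for v
    using that by (simp add: K_def T_def span_neg)
  have indep: "independent (b ` {..n})"
    using bB by (intro independent_mono[OF independent_Basis]) auto
  then have indep': "independent (b ` {..<n})"
    by (rule independent_mono) auto
  have "dim T = Suc n"
    unfolding T_def using inj by (simp add: dim_span dim_eq_card_independent[OF indep] card_image)
  moreover have "dim S = n"
    unfolding S_def using inj_on_subset[OF inj, of "{..<n}"]
    by (simp add: dim_span dim_eq_card_independent[OF indep'] card_image less_imp_le subset_iff)
  ultimately have dim: "dim S < dim T"
    by simp
  have ST: "S \<subseteq> T"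
    unfolding S_def T_def by (rule span_mono) auto
  have sub: "subspace S" "subspace T"
    by (simp_all add: S_def T_def)
  have compK: "compact K"
    unfolding K_def by (simp add: compact_Int_closed closed_subspace sub)
  define F where "F = (\<lambda>v. emb (f (co v)))"
  have F_T: "F ` K \<subseteq> T"
    by (auto simp: F_def emb_T)
  have f_in: "f x \<in> topspace (nsphere n)" if "x \<in> topspace (nsphere n)" for x
    using f that by (auto simp: continuous_map_def)
  have F_K: "F v \<in> K" if "v \<in> K" for v
    using that by (simp add: F_def emb_K f_in co_K)
  have contco: "continuous_map (top_of_set K) (nsphere n) co"
    unfolding continuous_map_into_nsphere_iff
  proof (intro conjI allI)
    show "continuous_map (top_of_set K) euclideanreal (\<lambda>v. co v i)" for i
      unfolding co_def by (cases "i \<le> n") (auto intro!: continuous_intros)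
    show "co ` topspace (top_of_set K) \<subseteq> topspace (nsphere n)"
      by (auto simp: co_K)
  qed
  have "continuous_map (top_of_set K) euclidean F"
    unfolding F_def emb_def
    using continuous_map_compose[OF contco f]
    by (intro continuous_intros)
       (auto simp: o_def continuous_map_into_nsphere_iff intro!: continuous_intros)
  then have contF: "continuous_on K F"
    by simp
  obtain p where p: "polynomial_function p" "p ` K \<subseteq> T"
    and pF: "\<And>v. v \<in> K \<Longrightarrow> norm (F v - p v) < 1"
    using Stone_Weierstrass_polynomial_function_subspace[OF compK contF _ sub(2) F_T, of 1]
    by auto
  define P where "P = (\<lambda>v. p v - p (- v))"
  have P_poly: "polynomial_function P"
  proof -
    have "polynomial_function (p \<circ> (\<lambda>v. - v))"
      by (intro polynomial_function_compose polynomial_function_minus p) auto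
    then show ?thesis
      unfolding P_def o_def by (intro polynomial_function_diff p)
  qed
  have P_neg: "P (- v) = - P v" for v
    by (simp add: P_def)
  have P_T: "P v \<in> T" if "v \<in> K" for v
    unfolding P_def using that K_neg p(2) sub(2) by (intro subspace_diff) auto
  have PF: "0 < P v \<bullet> F v" if v: "v \<in> K" for v
  proof -
    have "F (- v) = - F v"
      unfolding F_def by (simp add: co_neg odd co_K v emb_neg)
    then have "norm (2 *\<^sub>R F v - P v) = norm ((F v - p v) - (F (- v) - p (- v)))"
      by (simp add: P_def scaleR_2 algebra_simps)
    also have "\<dots> < 2"
      using pF[OF v] pF[OF K_neg[OF v]] norm_triangle_ineq4[of "F v - p v" "F (- v) - p (- v)"]
      by linarith
    finally have "(norm (2 *\<^sub>R F v - P v))\<^sup>2 < 2\<^sup>2"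
      by (intro power_strict_mono) auto
    moreover have "(norm (2 *\<^sub>R F v - P v))\<^sup>2 = 4 * (norm (F v))\<^sup>2 - 4 * (P v \<bullet> F v) + (norm (P v))\<^sup>2"
      by (simp add: power2_norm_eq_inner inner_diff_left inner_diff_right inner_commute)
    moreover have "norm (F v) = 1"
      using F_K[OF v] by (simp add: K_def)
    moreover have "0 \<le> (norm (P v))\<^sup>2"
      by simp
    ultimately show ?thesis
      by (simp, linarith)
  qed
  define Q where "Q = (\<lambda>v. P v /\<^sub>R norm (P v))"
  have P_nz: "P v \<noteq> 0" if "v \<in> K" for v
    using PF[OF that] by auto
  have Q_K: "Q v \<in> K" if "v \<in> K" for v
    using P_nz[OF that] P_T[OF that] sub(2) by (simp add: Q_def K_def subspace_scale)
  have "Q differentiable_on sphere 0 1 \<inter> S"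
    unfolding Q_def
    using P_nz ST
    by (intro derivative_intros differentiable_on_polynomial_function P_poly
        differentiable_on_compose[of P _ norm, unfolded o_def] differentiable_on_norm)
       (auto simp: K_def)
  (* The equator spans the subspace S, of smaller dimension than T; a differentiable map cannot
     carry its unit sphere onto that of T. *)
  from spheremap_lemma1[OF sub dim ST this]
  obtain w where w: "w \<in> K" "w \<notin> Q ` (sphere 0 1 \<inter> S)"
    using Q_K ST unfolding K_def by blast
  define g where "g = (\<lambda>x. normalize_to_sphere n (co (P (emb x))))"
  have co_nz: "\<exists>i\<le>n. co v i \<noteq> 0" if "v \<in> T" "v \<noteq> 0" for v
  proof (rule ccontr)
    assume "\<not> ?thesis"
    then have "emb (co v) = 0"
      by (simp add: emb_def)
    with that show False
      by (simp add: emb_co)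
  qed
  have cont_coP: "continuous_map (nsphere n) euclideanreal (\<lambda>x. co (P (emb x)) i)" for i
  proof -
    have "continuous_map (nsphere n) euclidean emb"
      unfolding emb_def
      by (subst nsphere_eq_top_of_set)
         (auto intro!: continuous_intros continuous_on_subset[OF continuous_on_product_coordinates])
    moreover have "continuous_map euclidean euclideanreal (\<lambda>v. co (P v) i)"
      using continuous_on_polymonial_function[OF P_poly, of UNIV]
      by (auto simp: co_def intro!: continuous_intros)
    ultimately show ?thesis
      by (rule continuous_map_compose[of _ _ emb _ "\<lambda>v. co (P v) i", unfolded o_def])
  qed
  show thesis
  proof
    show contg: "continuous_map (nsphere n) (nsphere n) g"
      unfolding g_def
      by (intro continuous_map_normalize_to_sphere cont_coP co_nz P_T P_nz emb_K)
    show "g (antipode x) = antipode (g x)" for x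
      by (simp add: g_def emb_neg P_neg co_neg normalize_to_sphere_antipode)
    have "homotopic_with (\<lambda>_. True) (nsphere n) (nsphere n)
            (\<lambda>x. normalize_to_sphere n (f x)) (\<lambda>x. normalize_to_sphere n (co (P (emb x))))"
    proof (rule homotopic_normalize_to_sphere)
      fix x and t :: real assume x: "x \<in> topspace (nsphere n)" and t: "0 \<le> t" "t \<le> 1"
      show "\<exists>i\<le>n. (1 - t) * f x i + t * co (P (emb x)) i \<noteq> 0"
      proof (rule ccontr)
        assume "\<not> ?thesis"
        then have "0 = emb (\<lambda>i. (1 - t) * f x i + t * co (P (emb x)) i)"
          by (simp add: emb_def)
        also have "\<dots> = (1 - t) *\<^sub>R emb (f x) + t *\<^sub>R emb (co (P (emb x)))"
          by (simp add: emb_def scaleR_add_left sum.distrib scaleR_sum_right)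
        also have "emb (co (P (emb x))) = P (emb x)"
          by (intro emb_co P_T emb_K x)
        also have "emb (f x) = F (emb x)"
          using x by (auto simp: F_def co_emb mem_nsphere_iff intro!: arg_cong[of _ _ emb] arg_cong[of _ _ f])
        finally have "0 = ((1 - t) *\<^sub>R F (emb x) + t *\<^sub>R P (emb x)) \<bullet> F (emb x)"
          by simp
        also have "\<dots> = (1 - t) + t * (P (emb x) \<bullet> F (emb x))"
          using F_K[OF emb_K[OF x]] by (simp add: inner_add_left K_def flip: power2_norm_eq_inner)
        also have "\<dots> > 0"
          using t PF[OF emb_K[OF x]] by (cases "t = 1") (auto intro: add_pos_nonneg)
        finally show False by simp
      qed
    qed (use f cont_coP in \<open>auto simp: continuous_map_into_nsphere_iff\<close>)
    then show "homotopic_with (\<lambda>_. True) (nsphere n) (nsphere n) f g"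
      unfolding g_def
      by (rule homotopic_with_eq) (auto simp: normalize_to_sphere_id f_in)
    show "co w \<in> topspace (nsphere n)"
      by (simp add: co_K w)
    show "co w \<notin> g ` topspace (nsphere (n - 1))"
    proof
      assume "co w \<in> g ` topspace (nsphere (n - 1))"
      then obtain x where x: "x \<in> topspace (nsphere (n - 1))" and wx: "co w = g x"
        by blast
      have xn: "x n = 0" and x0: "\<And>i. i > n \<Longrightarrow> x i = 0"
        using x n by (auto simp: mem_nsphere_iff)
      have sum_eq: "(\<Sum>i\<le>n. h i) = (\<Sum>i\<le>n - 1. h i) + h n" for h :: "nat \<Rightarrow> 'c::comm_monoid_add"
        using n(2) by (cases n) auto
      have "x \<in> topspace (nsphere n)"
        using x n xn x0 by (auto simp: mem_nsphere_iff sum_eq)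
      then have K: "emb x \<in> K"
        by (rule emb_K)
      have "emb x \<in> S"
        unfolding emb_def S_def sum_eq xn scaleR_zero_left add_0_right
        by (intro span_sum span_scale span_base) (use n in auto)
      moreover have "w = Q (emb x)"
      proof -
        have "w = emb (g x)"
          using w(1) by (simp add: K_def emb_co flip: wx)
        also have "\<dots> = emb (co (P (emb x))) /\<^sub>R norm (emb (co (P (emb x))))"
          unfolding norm_emb
          by (simp add: g_def normalize_to_sphere_def emb_def scaleR_sum_right divide_inverse_commute)
        also have "\<dots> = Q (emb x)"
          by (simp add: emb_co P_T K Q_def)
        finally show ?thesis .
      qed
      ultimately show False
        using w(2) K by (auto simp: K_def)
    qed
  qed
qed

text \<open>The Householder reflection in the hyperplane orthogonal to \<open>w = v - e\<^sub>n\<close> exchanges the unit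
vectors \<open>v\<close> and \<open>e\<^sub>n\<close>; here \<open>\<bar>w\<bar>\<^sup>2 = 2 (1 - v n)\<close>, which explains the denominator.\<close>

lemma sphere_reflection:
  assumes v: "v \<in> topspace (nsphere n)" and vn: "v n \<noteq> 1"
  obtains R where "homeomorphic_map (nsphere n) (nsphere n) R"
    and "\<And>x. R (antipode x) = antipode (R x)"
    and "\<And>x. R (R x) = x"
    and "R v = (\<lambda>i. if i = n then 1 else 0)"
proof -
  define w where "w = (\<lambda>i. v i - (if i = n then 1 else 0))"
  define ip where "ip = (\<lambda>y. \<Sum>j\<le>n. y j * w j)"
  define R where "R = (\<lambda>y i. y i - ip y / (1 - v n) * w i)"
  have v0: "v i = 0" if "i > n" for i
    using v that by (auto simp: mem_nsphere_iff)
  have v2: "(\<Sum>i\<le>n. v i * v i) = 1"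
    using v by (auto simp: mem_nsphere_iff power2_eq_square)
  have ipv: "ip v = 1 - v n"
  proof -
    have "ip v = (\<Sum>j\<le>n. v j * v j) - (\<Sum>j\<le>n. if j = n then v j else 0)"
      unfolding ip_def by (subst sum_subtractf[symmetric], rule sum.cong) (auto simp: w_def algebra_simps)
    then show ?thesis
      by (simp add: v2)
  qed
  have ipw: "ip w = 2 * (1 - v n)"
  proof -
    have "ip w = ip v - (\<Sum>j\<le>n. if j = n then w j else 0)"
      unfolding ip_def by (subst sum_subtractf[symmetric], rule sum.cong) (auto simp: w_def algebra_simps)
    then show ?thesis
      by (simp add: ipv w_def)
  qed
  have ipR: "ip (R y) = - ip y" for y
  proof -
    have "ip (R y) = ip y - ip y / (1 - v n) * ip w"
      unfolding ip_def R_def by (simp add: left_diff_distrib sum_subtractf sum_distrib_left mult.assoc)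
    also have "ip y / (1 - v n) * ip w = 2 * ip y"
      using vn unfolding ipw by (simp add: divide_simps)
    finally show ?thesis
      by simp
  qed
  have RR: "R (R y) = y" for y
  proof
    fix i
    have "R (R y) i = R y i - ip (R y) / (1 - v n) * w i"
      by (simp only: R_def)
    then show "R (R y) i = y i"
      unfolding ipR by (simp add: R_def)
  qed
  have "(\<Sum>i\<le>n. (R y i)\<^sup>2) = (\<Sum>i\<le>n. (y i)\<^sup>2)" for y
  proof -
    define c where "c = ip y / (1 - v n)"
    have "(\<Sum>i\<le>n. (R y i)\<^sup>2) = (\<Sum>i\<le>n. (y i)\<^sup>2 - 2 * c * (y i * w i) + c\<^sup>2 * (w i * w i))"
      by (rule sum.cong) (auto simp: R_def c_def power2_eq_square algebra_simps)
    also have "\<dots> = (\<Sum>i\<le>n. (y i)\<^sup>2) - 2 * c * ip y + c\<^sup>2 * ip w"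
      by (simp add: sum.distrib sum_subtractf ip_def sum_distrib_left)
    also have "ip y = c * (1 - v n)"
      using vn by (simp add: c_def)
    finally show ?thesis
      by (simp add: ipw power2_eq_square)
  qed
  then have R_mem: "R y \<in> topspace (nsphere n)" if "y \<in> topspace (nsphere n)" for y
    using that by (auto simp: mem_nsphere_iff R_def w_def v0)
  have contR: "continuous_map (nsphere n) (nsphere n) R"
    unfolding continuous_map_into_nsphere_iff using R_mem vn
    by (auto simp: R_def ip_def intro!: continuous_intros continuous_map_nsphere_projection)
  show thesis
  proof
    show "homeomorphic_map (nsphere n) (nsphere n) R"
      using contR RR homeomorphic_map_involution by fastforce
    show "R (antipode x) = antipode (R x)" for x
      by (rule ext) (simp add: R_def ip_def sum_negf)
    show "R v = (\<lambda>i. if i = n then 1 else 0)"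
      using vn by (auto simp: R_def ipv w_def)
  qed (rule RR)
qed

text \<open>Up to homotopy and a reflection, which change the degree at most by a sign, the map misses the
poles \<open>\<plusminus> e\<^sub>n\<close> on the equator \<open>x n = 0\<close>. Multiplying the last coordinate of the value by the
even function \<open>\<bar>x n\<bar>\<close> then flattens the image of the equator into the equator: the value can only
become zero where \<open>x n = 0\<close> and the image is a pole.\<close>

lemma odd_map_homotopic_preserving_equator:
  assumes n: "n < DIM('a::euclidean_space)" "0 < n"
    and f: "continuous_map (nsphere n) (nsphere n) f"
    and odd: "\<And>x. x \<in> topspace (nsphere n) \<Longrightarrow> f (antipode x) = antipode (f x)"
  obtains h where "continuous_map (nsphere n) (nsphere n) h"
    and "\<And>x. x \<in> topspace (nsphere n) \<Longrightarrow> h (antipode x) = antipode (h x)"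
    and "h ` topspace (nsphere (n - 1)) \<subseteq> topspace (nsphere (n - 1))"
    and "even (Brouwer_degree2 n h) \<longleftrightarrow> even (Brouwer_degree2 n f)"
proof -
  obtain g u where g: "continuous_map (nsphere n) (nsphere n) g"
    and g_odd: "\<And>x. x \<in> topspace (nsphere n) \<Longrightarrow> g (antipode x) = antipode (g x)"
    and fg: "homotopic_with (\<lambda>_. True) (nsphere n) (nsphere n) f g"
    and u: "u \<in> topspace (nsphere n)" "u \<notin> g ` topspace (nsphere (n - 1))"
    using odd_map_homotopic_missing_point[OF n f odd] by metis
  have equator: "x \<in> topspace (nsphere (n - 1)) \<longleftrightarrow> x \<in> topspace (nsphere n) \<and> x n = 0" for x
  proof -
    obtain m where m: "n = Suc m" using n(2) by (cases n) auto
    show ?thesis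
      using arg_cong[OF subtopology_nsphere_equator[of m], of topspace] by (auto simp: m)
  qed
  (* By oddness both u and its antipode are missed; the one with nonpositive last coordinate is
     certainly different from the pole, so that the reflection exists. *)
  define v where "v = (if u n \<le> 0 then u else antipode u)"
  have v: "v \<in> topspace (nsphere n)" and vn: "v n \<noteq> 1"
    using u by (auto simp: v_def)
  have missed: "g x \<noteq> v" "g x \<noteq> antipode v" if x: "x \<in> topspace (nsphere (n - 1))" for x
  proof -
    have "antipode x \<in> topspace (nsphere (n - 1))" "g (antipode x) = antipode (g x)"
      using x equator g_odd by auto
    then have "antipode (g x) \<noteq> u"
      using u(2) by (metis image_eqI)
    moreover have "g x \<noteq> u"
      using u(2) x by blast
    ultimately have "g x \<noteq> u" "g x \<noteq> antipode u"
      by auto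
    then show "g x \<noteq> v" "g x \<noteq> antipode v"
      by (cases "u n \<le> 0"; simp add: v_def)+
  qed
  obtain R where R: "homeomorphic_map (nsphere n) (nsphere n) R"
    and R_odd: "\<And>x. R (antipode x) = antipode (R x)"
    and RR: "\<And>x. R (R x) = x"
    and Rv: "R v = (\<lambda>i. if i = n then 1 else 0)"
    by (rule sphere_reflection[OF v vn]) (rule that; assumption)
  have contR: "continuous_map (nsphere n) (nsphere n) R"
    using R by (rule homeomorphic_imp_continuous_map)
  define y where "y = R \<circ> g"
  have conty: "continuous_map (nsphere n) (nsphere n) y"
    unfolding y_def by (rule continuous_map_compose[OF g contR])
  have y_odd: "y (antipode x) = antipode (y x)" if "x \<in> topspace (nsphere n)" for x
    using that by (simp add: y_def g_odd R_odd)
  have y_mem: "y x \<in> topspace (nsphere n)" if "x \<in> topspace (nsphere n)" for x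
    using conty that by (auto simp: continuous_map_def)
  have equator_nz: "\<exists>i<n. y x i \<noteq> 0" if x: "x \<in> topspace (nsphere n)" "x n = 0" for x
  proof (rule ccontr)
    assume none: "\<not> ?thesis"
    have xe: "x \<in> topspace (nsphere (n - 1))"
      using x by (simp only: equator)
    from none have zero: "y x i = 0" if "i < n" for i
      using that by auto
    have y1: "(\<Sum>i\<le>n. (y x i)\<^sup>2) = 1" "\<And>i. i > n \<Longrightarrow> y x i = 0"
      using y_mem[OF x(1)] by (auto simp: mem_nsphere_iff)
    have "(\<Sum>i\<le>n. (y x i)\<^sup>2) = (y x n)\<^sup>2"
      by (subst sum.remove[of _ n]) (auto simp: zero intro!: sum.neutral)
    then consider "y x n = 1" | "y x n = -1"
      using y1 by (auto simp: power2_eq_1_iff)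
    then show False
    proof cases
      case 1
      then have "y x = R v"
        using zero y1(2) by (intro ext) (metis Rv nat_neq_iff)
      then have "g x = v"
        using RR[of "g x"] by (simp add: y_def RR)
      then show False
        using missed(1)[OF xe] by simp
    next
      case 2
      then have "y x = R (antipode v)"
        using zero y1(2) unfolding R_odd
        by (intro ext) (metis Rv antipode_apply minus_zero nat_neq_iff)
      then have "g x = antipode v"
        using RR[of "g x"] by (simp add: y_def RR)
      then show False
        using missed(2)[OF xe] by simp
    qed
  qed
  define k where "k = (\<lambda>x i. if i = n then \<bar>x n\<bar> * y x n else y x i)"
  define h where "h = (\<lambda>x. normalize_to_sphere n (k x))"
  have nz: "\<exists>i\<le>n. (1 - t) * y x i + t * k x i \<noteq> 0"
    if x: "x \<in> topspace (nsphere n)" and t: "0 \<le> t" "t \<le> 1" for x t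
  proof (cases "\<exists>i<n. y x i \<noteq> 0")
    case True
    then obtain i where "i < n" "y x i \<noteq> 0" by blast
    then show ?thesis
      by (intro exI[of _ i]) (auto simp: k_def algebra_simps)
  next
    case False
    then have xn: "x n \<noteq> 0"
      using equator_nz[OF x] by blast
    have yn: "y x n \<noteq> 0"
    proof
      assume "y x n = 0"
      then have "y x i = 0" if "i \<le> n" for i
        using that False by (cases "i = n") auto
      then show False
        using y_mem[OF x] by (simp add: mem_nsphere_iff)
    qed
    have "(1 - t) + t * \<bar>x n\<bar> > 0"
      using t xn by (cases "t = 1") (auto intro: add_pos_nonneg)
    then have "((1 - t) + t * \<bar>x n\<bar>) * y x n \<noteq> 0"
      using yn by simp
    then show ?thesis
      by (intro exI[of _ n]) (simp add: k_def algebra_simps)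
  qed
  have contk: "continuous_map (nsphere n) euclideanreal (\<lambda>x. k x i)" for i
    using conty
    by (cases "i = n") (auto simp: k_def continuous_map_into_nsphere_iff
        intro!: continuous_intros continuous_map_nsphere_projection)
  have k_nz: "\<exists>i\<le>n. k x i \<noteq> 0" if "x \<in> topspace (nsphere n)" for x
    using nz[OF that, of 1] by simp
  have h: "continuous_map (nsphere n) (nsphere n) h"
    unfolding h_def by (intro continuous_map_normalize_to_sphere contk k_nz)
  have "homotopic_with (\<lambda>_. True) (nsphere n) (nsphere n) (\<lambda>x. normalize_to_sphere n (y x)) h"
    unfolding h_def using conty
    by (intro homotopic_normalize_to_sphere contk nz) (auto simp: continuous_map_into_nsphere_iff)
  then have "homotopic_with (\<lambda>_. True) (nsphere n) (nsphere n) y h"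
    by (rule homotopic_with_eq) (auto simp: normalize_to_sphere_id y_mem)
  then have "Brouwer_degree2 n h = Brouwer_degree2 n y"
    using Brouwer_degree2_homotopic by metis
  also have "\<dots> = Brouwer_degree2 n R * Brouwer_degree2 n g"
    unfolding y_def by (rule Brouwer_degree2_compose[OF g contR])
  also have "Brouwer_degree2 n g = Brouwer_degree2 n f"
    using Brouwer_degree2_homotopic[OF fg] by simp
  finally have deg: "Brouwer_degree2 n h = Brouwer_degree2 n R * Brouwer_degree2 n f" .
  show thesis
  proof
    show "h (antipode x) = antipode (h x)" if "x \<in> topspace (nsphere n)" for x
    proof -
      have "k (antipode x) = antipode (k x)"
        by (auto simp: k_def y_odd[OF that])
      then show ?thesis
        by (simp add: h_def normalize_to_sphere_antipode)
    qed
    show "h ` topspace (nsphere (n - 1)) \<subseteq> topspace (nsphere (n - 1))"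
    proof
      fix z assume "z \<in> h ` topspace (nsphere (n - 1))"
      then obtain x where x: "x \<in> topspace (nsphere n)" "x n = 0" "z = h x"
        using equator by blast
      then have "z n = 0"
        by (simp add: h_def normalize_to_sphere_def k_def)
      moreover have "z \<in> topspace (nsphere n)"
        using h x by (auto simp: continuous_map_def)
      ultimately show "z \<in> topspace (nsphere (n - 1))"
        by (simp only: equator)
    qed
    have "\<bar>Brouwer_degree2 n R\<bar> = 1"
      by (rule Brouwer_degree2_homeomorphic_map[OF R])
    then show "even (Brouwer_degree2 n h) \<longleftrightarrow> even (Brouwer_degree2 n f)"
      by (auto simp: deg abs_if split: if_splits)
  qed (rule h)
qed

text \<open>Borsuk's theorem. The degree of an odd map that preserves the equator has the same parity as the
degree of its restriction to the equator, so induction on the dimension leads down to the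
\<open>0\<close>-sphere, where an odd map is the identity or the antipodal map.\<close>

theorem odd_map_odd_degree:
  assumes "n < DIM('a::euclidean_space)"
    and "continuous_map (nsphere n) (nsphere n) f"
    and "\<And>x. x \<in> topspace (nsphere n) \<Longrightarrow> f (antipode x) = antipode (f x)"
  shows "odd (Brouwer_degree2 n f)"
  using assms
proof (induction n arbitrary: f)
  case 0
  have ff: "f (f x) = x" if x: "x \<in> topspace (nsphere 0)" for x
  proof -
    have pm: "y = x \<or> y = antipode x" if "y \<in> topspace (nsphere 0)" for y
    proof -
      have "(y 0)\<^sup>2 = 1" "(x 0)\<^sup>2 = 1" "\<And>i. i > 0 \<Longrightarrow> y i = 0 \<and> x i = 0"
        using x that by (auto simp: mem_nsphere_iff)
      then have "y 0 = x 0 \<or> y 0 = - x 0" "\<And>i. i > 0 \<Longrightarrow> y i = 0 \<and> x i = 0"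
        by (auto simp: power2_eq_1_iff)
      then show ?thesis
        by (auto simp: fun_eq_iff) (metis gr0I minus_zero)+
    qed
    have "f x \<in> topspace (nsphere 0)"
      using 0 x by (auto simp: continuous_map_def)
    then show ?thesis
      using pm[of "f x"] 0(3)[OF x] by (metis antipode_antipode)
  qed
  then have "homeomorphic_map (nsphere 0) (nsphere 0) f"
    using homeomorphic_map_involution[OF 0(2)] by blast
  then have "\<bar>Brouwer_degree2 0 f\<bar> = 1"
    by (rule Brouwer_degree2_homeomorphic_map)
  then show ?case
    by (auto simp: abs_if split: if_splits)
next
  case (Suc n)
  obtain h where h: "continuous_map (nsphere (Suc n)) (nsphere (Suc n)) h"
    and h_odd: "\<And>x. x \<in> topspace (nsphere (Suc n)) \<Longrightarrow> h (antipode x) = antipode (h x)"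
    and him: "h ` topspace (nsphere n) \<subseteq> topspace (nsphere n)"
    and par: "even (Brouwer_degree2 (Suc n) h) \<longleftrightarrow> even (Brouwer_degree2 (Suc n) f)"
    using odd_map_homotopic_preserving_equator[OF Suc.prems(1) _ Suc.prems(2,3)]
    by (metis diff_Suc_1 zero_less_Suc)
  have sub: "topspace (nsphere n) \<subseteq> topspace (nsphere (Suc n))"
    by (auto simp: mem_nsphere_iff)
  have "continuous_map (nsphere n) (nsphere n) h"
    using h him
    by (metis continuous_map_from_subtopology continuous_map_into_nsphere_iff subtopology_nsphere_equator)
  then have "odd (Brouwer_degree2 n h)"
  proof (rule Suc.IH[rotated])
    show "h (antipode x) = antipode (h x)" if "x \<in> topspace (nsphere n)" for x
      using h_odd sub that by blast
  qed (use Suc.prems(1) in simp)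
  moreover have "even (Brouwer_degree2 (Suc n) h - Brouwer_degree2 (Suc n - Suc 0) h)"
    using h h_odd him
    by (intro Borsuk_odd_mapping_degree_step) (auto simp: antipode_def fun_eq_iff)
  ultimately show ?case
    using par by simp
qed

text \<open>Without a common zero, the \<open>n\<close> functions together with the zero function as last coordinate would
give an odd map of the sphere to itself that misses a pole, hence has degree \<open>0\<close>.\<close>

theorem Borsuk_Ulam_nonvanishing:
  fixes F :: "nat \<Rightarrow> (nat \<Rightarrow> real) \<Rightarrow> real"
  assumes dim: "n < DIM('a::euclidean_space)"
    and cont: "\<And>i. i < n \<Longrightarrow> continuous_map (nsphere n) euclideanreal (F i)"
    and odd: "\<And>i x. \<lbrakk>i < n; x \<in> topspace (nsphere n)\<rbrakk> \<Longrightarrow> F i (antipode x) = - F i x"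
  shows "\<exists>x\<in>topspace (nsphere n). \<forall>i<n. F i x = 0"
proof (rule ccontr)
  assume neg: "\<not> ?thesis"
  define k where "k = (\<lambda>x i. if i < n then F i x else 0)"
  define f where "f = (\<lambda>x. normalize_to_sphere n (k x))"
  have nz: "\<exists>i\<le>n. k x i \<noteq> 0" if "x \<in> topspace (nsphere n)" for x
    using neg that by (force simp: k_def)
  have "continuous_map (nsphere n) euclideanreal (\<lambda>x. k x i)" for i
    using cont by (cases "i < n") (auto simp: k_def)
  then have f: "continuous_map (nsphere n) (nsphere n) f"
    unfolding f_def by (intro continuous_map_normalize_to_sphere nz)
  have "k (antipode x) = antipode (k x)" if "x \<in> topspace (nsphere n)" for x
    using odd that by (auto simp: k_def)
  then have "f (antipode x) = antipode (f x)" if "x \<in> topspace (nsphere n)" for x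
    using that by (simp add: f_def normalize_to_sphere_antipode)
  then have "odd (Brouwer_degree2 n f)"
    by (rule odd_map_odd_degree[OF dim f])
  moreover have "Brouwer_degree2 n f = 0"
  proof (rule Brouwer_degree2_nonsurjective[OF f])
    have "(\<lambda>i. if i = n then 1 else 0) \<in> topspace (nsphere n)"
      by (simp add: mem_nsphere_iff if_distrib[of "\<lambda>x. x\<^sup>2"] cong: if_cong)
    moreover have "(\<lambda>i. if i = n then 1 else 0) \<noteq> f x" for x
      by (auto simp: f_def normalize_to_sphere_def k_def fun_eq_iff intro!: exI[of _ n])
    ultimately show "f ` topspace (nsphere n) \<noteq> topspace (nsphere n)"
      by blast
  qed
  ultimately show False
    by simp
qed

section \<open>Path spaces and real projective spaces\<close>

text \<open>The exponential law for the compact interval. Evaluation is continuous because each parameter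
\<open>t\<close> has arbitrarily small compact neighbourhoods, to which the subbasic open sets of the
compact-open topology apply.\<close>

lemma continuous_map_path_space_eval:
  assumes s: "continuous_map W (path_space X) s"
  shows "continuous_map (prod_topology W (top_of_set {0..1})) X (\<lambda>(w, t). s w t)"
proof -
  have path: "continuous_map (top_of_set {0..1}) X (s w)" if "w \<in> topspace W" for w
    using s that by (auto simp: path_space_def continuous_map_def topspace_compact_open_topology)
  have openW: "openin W {w \<in> topspace W. s w ` J \<subseteq> U}"
    if J: "compactin (top_of_set {0..1}) J" and U: "openin X U" for J U
  proof -
    let ?B = "{f \<in> extensional (topspace (top_of_set {0..1})). continuous_map (top_of_set {0..1}) X f \<and> f ` J \<subseteq> U}"
    have "openin (path_space X) ?B"
      unfolding path_space_def compact_open_topology_def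
      by (rule topology_generated_by_Basis) (use J U in blast)
    then have "openin W {w \<in> topspace W. s w \<in> ?B}"
      using s by (rule openin_continuous_map_preimage[rotated])
    moreover have "s w \<in> topspace (path_space X)" if "w \<in> topspace W" for w
      using s that by (auto simp: continuous_map_def)
    then have "{w \<in> topspace W. s w \<in> ?B} = {w \<in> topspace W. s w ` J \<subseteq> U}"
      by (auto simp: path_space_def topspace_compact_open_topology)
    ultimately show ?thesis
      by simp
  qed
  show ?thesis
    unfolding continuous_map_def
  proof (intro conjI allI impI)
    show "(\<lambda>(w, t). s w t) \<in> topspace (prod_topology W (top_of_set {0..1})) \<rightarrow> topspace X"
      using path by (auto simp: continuous_map_def)
  next
    fix U assume U: "openin X U"
    show "openin (prod_topology W (top_of_set {0..1}))
            {z \<in> topspace (prod_topology W (top_of_set {0..1})). (case z of (w, t) \<Rightarrow> s w t) \<in> U}"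
      unfolding openin_prod_topology_alt
    proof (intro allI impI)
      fix w :: 'a and t :: real
      assume "(w, t) \<in> {z \<in> topspace (prod_topology W (top_of_set {0..1})). (case z of (w, t) \<Rightarrow> s w t) \<in> U}"
      then have w: "w \<in> topspace W" and t: "t \<in> {0..1}" and wt: "s w t \<in> U"
        by auto
      have "openin (top_of_set {0..1}) {t \<in> {0..1}. s w t \<in> U}"
        using openin_continuous_map_preimage[OF path[OF w] U] by simp
      then obtain e where e: "e > 0" "cball t e \<inter> {0..1} \<subseteq> {t \<in> {0..1}. s w t \<in> U}"
        using t wt by (auto simp: openin_contains_cball)
      let ?J = "cball t e \<inter> {0..1}"
      have J: "compactin (top_of_set {0..1}) ?J"
        by (simp add: compactin_subtopology compact_Int)
      have "openin (top_of_set {0..1}) (ball t e \<inter> {0..1})"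
        by (metis Int_commute open_ball openin_open_Int)
      moreover have "w \<in> {w \<in> topspace W. s w ` ?J \<subseteq> U}" "t \<in> ball t e \<inter> {0..1}"
        using w e t by auto
      moreover have "{w \<in> topspace W. s w ` ?J \<subseteq> U} \<times> (ball t e \<inter> {0..1}) \<subseteq>
          {z \<in> topspace (prod_topology W (top_of_set {0..1})). (case z of (w, t) \<Rightarrow> s w t) \<in> U}"
        by (auto simp: image_subset_iff)
      ultimately show "\<exists>A B. openin W A \<and> openin (top_of_set {0..1}) B \<and> w \<in> A \<and> t \<in> B \<and> A \<times> B \<subseteq>
          {z \<in> topspace (prod_topology W (top_of_set {0..1})). (case z of (w, t) \<Rightarrow> s w t) \<in> U}"
        using openW[OF J U] by blast
    qed
  qed
qed

text \<open>The converse half of the exponential law is the tube lemma.\<close>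

lemma continuous_map_path_space_curry:
  assumes G: "continuous_map (prod_topology W (top_of_set {0..1})) X G"
  shows "continuous_map W (path_space X) (\<lambda>w. restrict (\<lambda>t. G (w, t)) {0..1})"
    (is "continuous_map W _ ?s")
proof -
  have path: "continuous_map (top_of_set {0..1}) X (?s w)" if "w \<in> topspace W" for w
  proof -
    have "continuous_map (top_of_set {0..1}) (prod_topology W (top_of_set {0..1})) (\<lambda>t. (w, t))"
      using that by (auto intro!: continuous_map_pairedI)
    from continuous_map_compose[OF this G] have "continuous_map (top_of_set {0..1}) X (\<lambda>t. G (w, t))"
      by (simp add: o_def)
    then show ?thesis
      by (rule continuous_map_eq) auto
  qed
  show ?thesis
    unfolding path_space_def compact_open_topology_def
  proof (rule continuous_on_generated_topo)
    fix \<B> assume "\<B> \<in> {{f \<in> extensional (topspace (top_of_set {0..1::real})). continuous_map (top_of_set {0..1}) X f \<and> f ` K \<subseteq> U} | K U.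
          compactin (top_of_set {0..1}) K \<and> openin X U}"
    then obtain K U where K: "compactin (top_of_set {0..1}) K" and U: "openin X U"
      and B: "\<B> = {f \<in> extensional (topspace (top_of_set {0..1})). continuous_map (top_of_set {0..1}) X f \<and> f ` K \<subseteq> U}"
      by blast
    have KI: "K \<subseteq> {0..1}"
      using compactin_subset_topspace[OF K] by simp
    let ?Z = "{z \<in> topspace (prod_topology W (top_of_set {0..1})). G z \<in> U}"
    have Z: "openin (prod_topology W (top_of_set {0..1})) ?Z"
      by (rule openin_continuous_map_preimage[OF G U])
    have "?s -` \<B> \<inter> topspace W = {w \<in> topspace W. {w} \<times> K \<subseteq> ?Z}"
    proof -
      have "?s w ` K = (\<lambda>t. G (w, t)) ` K" for w
        using KI by (intro image_cong) auto
      then have "?s w \<in> \<B> \<longleftrightarrow> {w} \<times> K \<subseteq> ?Z" if "w \<in> topspace W" for w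
        using KI path[OF that] that by (auto simp: B image_subset_iff)
      then show ?thesis
        by blast
    qed
    also have "openin W \<dots>"
    proof (subst openin_subopen, intro ballI)
      fix w assume "w \<in> {w \<in> topspace W. {w} \<times> K \<subseteq> ?Z}"
      then obtain A V where "openin W A" "w \<in> A" "K \<subseteq> V" "A \<times> V \<subseteq> ?Z"
        using tube_lemma_right[OF Z K, of w] by blast
      then show "\<exists>T. openin W T \<and> w \<in> T \<and> T \<subseteq> {w \<in> topspace W. {w} \<times> K \<subseteq> ?Z}"
        using openin_subset by (intro exI[of _ A]) blast
    qed
    finally show "openin W (?s -` \<B> \<inter> topspace W)" .
  next
    show "?s ` topspace W \<subseteq> \<Union> {{f \<in> extensional (topspace (top_of_set {0..1})). continuous_map (top_of_set {0..1}) X f \<and> f ` K \<subseteq> U} | K U.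
          compactin (top_of_set {0..1}) K \<and> openin X U}"
    proof (intro subsetI UnionI)
      fix f assume f: "f \<in> ?s ` topspace W"
      show "f \<in> {f \<in> extensional (topspace (top_of_set {0..1})). continuous_map (top_of_set {0..1}) X f \<and> f ` {} \<subseteq> {}}"
        using f path by auto
    qed (use compactin_empty openin_empty in blast)
  qed
qed

definition antipodal_pair :: "(nat \<Rightarrow> real) \<Rightarrow> (nat \<Rightarrow> real) set" where
  "antipodal_pair x = {x, antipode x}"

lemma antipodal_pair_antipode [simp]: "antipodal_pair (antipode x) = antipodal_pair x"
  by (auto simp: antipodal_pair_def)

lemma antipodal_pair_eq_iff: "antipodal_pair x = antipodal_pair y \<longleftrightarrow> x = y \<or> x = antipode y"
  unfolding antipodal_pair_def doubleton_eq_iff by (metis antipode_antipode)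

lemma real_projective_space_eq:
  "real_projective_space n = quotient_topology (nsphere n) antipodal_pair"
  by (simp add: real_projective_space_def antipodal_pair_def[abs_def] antipode_def)

lemma quotient_map_antipodal_pair:
  "quotient_map (nsphere n) (real_projective_space n) antipodal_pair"
  by (simp add: real_projective_space_eq quotient_map_quotient_topology)

lemma continuous_map_antipodal_pair:
  "continuous_map (nsphere n) (real_projective_space n) antipodal_pair"
  by (rule quotient_imp_continuous_map[OF quotient_map_antipodal_pair])

lemma topspace_real_projective_space:
  "topspace (real_projective_space n) = antipodal_pair ` topspace (nsphere n)"
  by (simp add: real_projective_space_eq topspace_quotient_topology)

text \<open>The saturation of an open set is its union with its antipodal copy. Openness, unlike being a
quotient map, passes to the product of two copies.\<close>

lemma open_map_antipodal_pair:
  "open_map (nsphere n) (real_projective_space n) antipodal_pair"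
  unfolding open_map_def
proof (intro allI impI)
  fix U assume U: "openin (nsphere n) U"
  have "{x \<in> topspace (nsphere n). antipodal_pair x \<in> antipodal_pair ` U}
      = U \<union> {x \<in> topspace (nsphere n). antipode x \<in> U}"
    (is "?L = ?R")
  proof
    show "?L \<subseteq> ?R"
      by (auto simp: antipodal_pair_eq_iff)
    show "?R \<subseteq> ?L"
      using openin_subset[OF U] by (auto intro: rev_image_eqI)
  qed
  then have "openin (nsphere n) {x \<in> topspace (nsphere n). antipodal_pair x \<in> antipodal_pair ` U}"
    using U openin_continuous_map_preimage[OF continuous_map_antipode U] by (simp add: openin_Un)
  then show "openin (real_projective_space n) (antipodal_pair ` U)"
    using openin_subset[OF U] by (auto simp: real_projective_space_eq openin_quotient_topology)
qed

text \<open>A representative cannot be chosen continuously, but expressions that are even in it, such as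
the entries of the orthogonal projection onto the line, depend continuously on the line.\<close>

definition representative :: "(nat \<Rightarrow> real) set \<Rightarrow> nat \<Rightarrow> real" where
  "representative L = (SOME x. L = antipodal_pair x)"

lemma representative_antipodal_pair:
  "representative (antipodal_pair x) = x \<or> representative (antipodal_pair x) = antipode x"
proof -
  have "antipodal_pair x = antipodal_pair (representative (antipodal_pair x))"
    unfolding representative_def by (rule someI[of "\<lambda>y. antipodal_pair x = antipodal_pair y"]) (rule refl)
  then show ?thesis
    unfolding antipodal_pair_eq_iff by (metis antipode_antipode)
qed

lemma representative_mem:
  assumes "L \<in> topspace (real_projective_space n)"
  shows "representative L \<in> topspace (nsphere n)"
  using assms representative_antipodal_pair unfolding topspace_real_projective_space
  by (metis antipode_mem_nsphere imageE)

lemma continuous_map_projection_matrix: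
  "continuous_map (real_projective_space n) euclideanreal
     (\<lambda>L. representative L a * representative L b)"
proof (rule continuous_compose_quotient_map[OF quotient_map_antipodal_pair])
  have "representative (antipodal_pair x) a * representative (antipodal_pair x) b = x a * x b" for x
    using representative_antipodal_pair[of x] by auto
  then show "continuous_map (nsphere n) euclideanreal
      ((\<lambda>L. representative L a * representative L b) \<circ> antipodal_pair)"
    by (auto simp: o_def intro!: continuous_intros continuous_map_nsphere_projection)
qed

section \<open>The lower bound\<close>

lemma prod_topology_top_of_set_subtopology:
  assumes "W \<subseteq> topspace (nsphere n)"
  shows "prod_topology (subtopology (nsphere n) W) (top_of_set T) = top_of_set (W \<times> T)"
proof -
  have "subtopology (nsphere n) W = top_of_set W"
    by (subst nsphere_eq_top_of_set) (use assms in \<open>simp add: subtopology_subtopology inf.absorb2\<close>)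
  then show ?thesis
    by simp
qed

text \<open>The squared cosine \<open>D (z, t, t')\<close> of the angle between the lines at times \<open>t\<close> and \<open>t'\<close> is continuous
even though the representatives \<open>r z t\<close> need not be, and it equals \<open>1\<close> on the diagonal. By
compactness it stays positive uniformly near the diagonal.\<close>

lemma uniform_nonorthogonal_subdivision:
  fixes r :: "'x::metric_space \<Rightarrow> real \<Rightarrow> nat \<Rightarrow> real"
  assumes K: "compact K"
    and r: "\<And>z t. \<lbrakk>z \<in> K; t \<in> {0..1}\<rbrakk> \<Longrightarrow> r z t \<in> topspace (nsphere n)"
    and cont: "\<And>a b. continuous_on (K \<times> {0..1}) (\<lambda>(z, t). r z t a * r z t b)"
  obtains \<delta> where "\<delta> > 0"
    and "\<And>z t t'. \<lbrakk>z \<in> K; t \<in> {0..1}; t' \<in> {0..1}; \<bar>t - t'\<bar> < \<delta>\<rbrakk> \<Longrightarrow>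
           (\<Sum>a\<le>n. r z t a * r z t' a) \<noteq> 0"
proof -
  define D where "D = (\<lambda>(z, t, t'). (\<Sum>a\<le>n. r z t a * r z t' a)\<^sup>2)"
  have D_alt: "D (z, t, t') = (\<Sum>a\<le>n. \<Sum>b\<le>n. (r z t a * r z t b) * (r z t' a * r z t' b))" for z t t'
    by (simp add: D_def power2_eq_square sum_product algebra_simps)
  let ?M = "K \<times> {0..1::real} \<times> {0..1::real}"
  have "continuous_on ?M D"
  proof -
    have c1: "continuous_on ?M (\<lambda>w. r (fst w) (fst (snd w)) a * r (fst w) (fst (snd w)) b)" for a b
      by (rule continuous_on_compose2[OF cont[of a b], of ?M "\<lambda>w. (fst w, fst (snd w))", unfolded prod.case])
         (auto intro!: continuous_intros)
    have c2: "continuous_on ?M (\<lambda>w. r (fst w) (snd (snd w)) a * r (fst w) (snd (snd w)) b)" for a b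
      by (rule continuous_on_compose2[OF cont[of a b], of ?M "\<lambda>w. (fst w, snd (snd w))", unfolded prod.case])
         (auto intro!: continuous_intros)
    have "continuous_on ?M (\<lambda>w. \<Sum>a\<le>n. \<Sum>b\<le>n.
        (r (fst w) (fst (snd w)) a * r (fst w) (fst (snd w)) b) *
        (r (fst w) (snd (snd w)) a * r (fst w) (snd (snd w)) b))"
      by (rule c1 c2 continuous_on_sum continuous_on_mult)+
    then show ?thesis
      by (rule continuous_on_eq) (auto simp: D_alt)
  qed
  moreover have "compact ?M"
    using K by (intro compact_Times) auto
  ultimately have "uniformly_continuous_on ?M D"
    by (rule compact_uniformly_continuous)
  then obtain \<delta> where \<delta>: "\<delta> > 0"
    and D_close: "\<And>w w'. \<lbrakk>w \<in> ?M; w' \<in> ?M; dist w' w < \<delta>\<rbrakk> \<Longrightarrow> dist (D w') (D w) < 1"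
    unfolding uniformly_continuous_on_def by (metis zero_less_one)
  show thesis
  proof
    fix z t t' assume z: "z \<in> K" and t: "t \<in> {0..1}" "t' \<in> {0..1}" "\<bar>t - t'\<bar> < \<delta>"
    have "D (z, t, t) = 1"
      using r[OF z t(1)] by (simp add: D_def mem_nsphere_iff power2_eq_square)
    moreover have "dist (D (z, t, t')) (D (z, t, t)) < 1"
      using z t by (intro D_close) (auto simp: dist_Pair_Pair dist_real_def abs_minus_commute)
    ultimately show "(\<Sum>a\<le>n. r z t a * r z t' a) \<noteq> 0"
      by (auto simp: D_def dist_real_def)
  qed (rule \<delta>)
qed

text \<open>An elementary substitute for path lifting along the double covering of projective space:
starting from \<open>z\<close>, which lies on the line at time \<open>1\<close>, the vector is projected orthogonally onto
the lines at times \<open>1 - 1/N\<close>, \<open>1 - 2/N\<close>, \<open>\<dots>\<close>, \<open>0\<close>. The choice of the unit vectors \<open>r t\<close> on the lines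
does not influence the result, and the result is linear in \<open>z\<close>.\<close>

primrec transported :: "nat \<Rightarrow> nat \<Rightarrow> (real \<Rightarrow> nat \<Rightarrow> real) \<Rightarrow> (nat \<Rightarrow> real) \<Rightarrow> nat \<Rightarrow> nat \<Rightarrow> real" where
  "transported n N r z 0 = z"
| "transported n N r z (Suc j) =
     (\<lambda>a. \<Sum>b\<le>n. (r (1 - Suc j / N) a * r (1 - Suc j / N) b) * transported n N r z j b)"

lemma transported_antipode:
  "transported n N r (antipode z) j = antipode (transported n N r z j)"
  by (induction j) (auto simp: sum_negf)

text \<open>Projecting onto a line that is not orthogonal does not kill the vector.\<close>

lemma transported_nonzero:
  assumes z: "z = r 1 \<or> z = antipode (r 1)"
    and nz: "\<And>j. j < N \<Longrightarrow> (\<Sum>a\<le>n. r (1 - Suc j / N) a * r (1 - j / N) a) \<noteq> 0"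
    and j: "j \<le> N"
  shows "\<exists>c. c \<noteq> 0 \<and> transported n N r z j = (\<lambda>a. c * r (1 - j / N) a)"
  using j
proof (induction j)
  case 0
  show ?case
  proof (cases "z = r 1")
    case True
    then show ?thesis
      by (intro exI[of _ 1]) auto
  next
    case False
    then show ?thesis
      using z by (intro exI[of _ "-1"]) (auto simp: antipode_def)
  qed
next
  case (Suc j)
  then obtain c where c: "c \<noteq> 0" "transported n N r z j = (\<lambda>a. c * r (1 - j / N) a)"
    by auto
  let ?s = "\<Sum>a\<le>n. r (1 - Suc j / N) a * r (1 - j / N) a"
  have "transported n N r z (Suc j) = (\<lambda>a. (c * ?s) * r (1 - Suc j / N) a)"
    by (rule ext) (simp add: c(2) sum_distrib_left sum_distrib_right mult_ac)
  then show ?case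
    using c(1) nz[of j] Suc.prems by (intro exI[of _ "c * ?s"]) auto
qed

lemma continuous_on_transported:
  fixes r :: "(nat \<Rightarrow> real) \<Rightarrow> real \<Rightarrow> nat \<Rightarrow> real"
  assumes cont: "\<And>a b. continuous_on (W \<times> {0..1}) (\<lambda>(z, t). r z t a * r z t b)"
    and j: "j \<le> N"
  shows "continuous_on W (\<lambda>z. transported n N (r z) z j a)"
  using j
proof (induction j arbitrary: a)
  case 0
  show ?case
    by (simp add: continuous_on_subset[OF continuous_on_product_coordinates])
next
  case (Suc j)
  have "1 - Suc j / N \<in> {0..1}"
    using Suc.prems by (simp add: divide_simps)
  then have c1: "continuous_on W (\<lambda>z. r z (1 - Suc j / N) a * r z (1 - Suc j / N) b)" for b
    by (intro continuous_on_compose2[OF cont[of a b], of W "\<lambda>z. (z, 1 - Suc j / N)", unfolded prod.case])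
       (auto intro!: continuous_intros)
  have c2: "continuous_on W (\<lambda>z. transported n N (r z) z j b)" for b
    using Suc by simp
  show ?case
    unfolding transported.simps by (rule c1 c2 continuous_on_sum continuous_on_mult)+
qed

lemma infdist_antipode:
  assumes "\<And>x. antipode x \<in> C \<longleftrightarrow> x \<in> C"
  shows "infdist (antipode z) C = infdist z C"
proof -
  have dist: "dist (antipode x) (antipode y) = dist x y" for x y
    by (simp add: dist_fun_def dist_real_def abs_minus_commute)
  have "C = antipode ` C"
    using assms by (force simp: image_iff intro: bexI[of _ "antipode _"])
  then have "(INF a\<in>C. dist (antipode z) a) = (INF a\<in>antipode ` C. dist (antipode z) a)"
    by simp
  also have "\<dots> = (INF a\<in>C. dist z a)"
    by (simp add: image_image dist)
  finally show ?thesis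
    by (simp add: infdist_def)
qed

text \<open>On \<open>W\<close> every line \<open>{z, - z}\<close> comes with a path \<open>H z\<close> from a fixed base line to it, depending
continuously on \<open>z\<close>. Transporting \<open>z\<close> back along the path gives a multiple of the base vector,
and the factor is an odd continuous function of \<open>z\<close>; this expresses that the double covering
is trivial over the image of \<open>W\<close>. The number \<open>N\<close> of subdivision steps is chosen so large that the
factor does not vanish on the compact set \<open>K\<close>. The cut-off function \<open>\<psi>\<close>, which vanishes on the
neighbourhood \<open>V\<close> of the complement of \<open>W\<close>, extends the function to the whole sphere.\<close>

lemma odd_function_of_local_section:
  fixes H :: "(nat \<Rightarrow> real) \<Rightarrow> real \<Rightarrow> (nat \<Rightarrow> real) set"
    and \<psi> :: "(nat \<Rightarrow> real) \<Rightarrow> real"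
  assumes W: "openin (nsphere n) W"
    and W_sym: "\<And>z. antipode z \<in> W \<longleftrightarrow> z \<in> W"
    and K: "compact K" "K \<subseteq> W"
    and \<psi>: "continuous_on (topspace (nsphere n)) \<psi>"
      "\<And>z. \<psi> (antipode z) = \<psi> z" "\<And>z. z \<in> K \<Longrightarrow> \<psi> z \<noteq> 0"
    and V: "openin (nsphere n) V" "V \<union> W = topspace (nsphere n)" "\<And>z. z \<in> V \<Longrightarrow> \<psi> z = 0"
    and H: "continuous_map (prod_topology (subtopology (nsphere n) W) (top_of_set {0..1}))
              (real_projective_space n) (\<lambda>(z, t). H z t)"
    and H_sym: "\<And>z. z \<in> W \<Longrightarrow> H (antipode z) = H z"
    and H0: "\<And>z. z \<in> W \<Longrightarrow> H z 0 = antipodal_pair (\<lambda>i. if i = 0 then 1 else 0)"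
    and H1: "\<And>z. z \<in> W \<Longrightarrow> H z 1 = antipodal_pair z"
  obtains G where "continuous_map (nsphere n) euclideanreal G"
    and "\<And>z. G (antipode z) = - G z"
    and "\<And>z. z \<in> K \<Longrightarrow> G z \<noteq> 0"
proof -
  have W_sub: "W \<subseteq> topspace (nsphere n)"
    using W by (rule openin_subset)
  define r where "r = (\<lambda>z t. representative (H z t))"
  have r_mem: "r z t \<in> topspace (nsphere n)" if "z \<in> W" "t \<in> {0..1}" for z t
  proof -
    have "(\<lambda>(z, t). H z t) (z, t) \<in> topspace (real_projective_space n)"
      using that W_sub by (intro continuous_map_image_subset_topspace[OF H, THEN subsetD] imageI) auto
    then show ?thesis
      by (simp add: r_def representative_mem)
  qed
  have cont: "continuous_on (W \<times> {0..1}) (\<lambda>(z, t). r z t a * r z t b)" for a b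
    using continuous_map_compose[OF H continuous_map_projection_matrix[of n a b]]
    by (simp add: prod_topology_top_of_set_subtopology[OF W_sub] r_def o_def case_prod_unfold)
  obtain \<delta> where \<delta>: "\<delta> > 0"
    and nonorth: "\<And>z t t'. \<lbrakk>z \<in> K; t \<in> {0..1}; t' \<in> {0..1}; \<bar>t - t'\<bar> < \<delta>\<rbrakk> \<Longrightarrow>
           (\<Sum>a\<le>n. r z t a * r z t' a) \<noteq> 0"
  proof (rule uniform_nonorthogonal_subdivision[OF K(1), of r n])
    show "continuous_on (K \<times> {0..1}) (\<lambda>(z, t). r z t a * r z t b)" for a b
      using K(2) by (intro continuous_on_subset[OF cont]) auto
  qed (use r_mem K(2) in blast)+
  obtain N :: nat where N: "1 / \<delta> < N"
    using reals_Archimedean2 by blast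
  then have N0: "N > 0"
    using \<delta> by (auto intro: Nat.gr0I)
  have N\<delta>: "1 / N < \<delta>"
    using N N0 \<delta> by (simp add: field_simps)
  define F where "F = (\<lambda>z. transported n N (r z) z N 0)"
  have contF: "continuous_on W F"
    unfolding F_def by (rule continuous_on_transported[OF cont]) auto
  have F_odd: "F (antipode z) = - F z" if "z \<in> W" for z
    using H_sym[OF that] by (simp add: F_def r_def transported_antipode)
  have F_nz: "F z \<noteq> 0" if z: "z \<in> K" for z
  proof -
    have zW: "z \<in> W"
      using z K by blast
    have "z = r z 1 \<or> z = antipode (r z 1)"
      using representative_antipodal_pair[of z] H1[OF zW] by (auto simp: r_def)
    moreover have "(\<Sum>a\<le>n. r z (1 - Suc j / N) a * r z (1 - j / N) a) \<noteq> 0" if "j < N" for j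
    proof (rule nonorth[OF z])
      have "(1 - Suc j / N) - (1 - j / N) = - (1 / N)"
        by (simp add: add_divide_distrib)
      then show "\<bar>(1 - Suc j / N) - (1 - j / N)\<bar> < \<delta>"
        using N\<delta> by simp
    qed (use that in \<open>auto simp: divide_simps\<close>)
    ultimately obtain c where "c \<noteq> 0" "transported n N (r z) z N = (\<lambda>a. c * r z (1 - N / N) a)"
      using transported_nonzero[of z "r z" N n N] by blast
    then have "F z = c * r z 0 0"
      using N0 by (simp add: F_def)
    moreover have "r z 0 0 \<noteq> 0"
      using representative_antipodal_pair[of "\<lambda>i. if i = 0 then 1 else 0"] H0[OF zW]
      by (auto simp: r_def)
    ultimately show ?thesis
      using \<open>c \<noteq> 0\<close> by simp
  qed
  define G where "G = (\<lambda>z. if z \<in> W then \<psi> z * F z else 0)"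
  have "continuous_on W G"
    using continuous_on_mult[OF continuous_on_subset[OF \<psi>(1) W_sub] contF]
    by (rule continuous_on_eq) (simp add: G_def)
  moreover have "continuous_on V G"
    using continuous_on_const[of V 0] by (rule continuous_on_eq) (simp add: G_def V(3))
  ultimately have "continuous_on (V \<union> W) G"
    using W V(1) nsphere_eq_top_of_set[of n]
    by (intro continuous_on_Un_local_open) (simp_all add: V(2))
  then have "continuous_map (nsphere n) euclideanreal G"
    by (subst nsphere_eq_top_of_set) (simp add: V(2))
  moreover have "G (antipode z) = - G z" for z
    by (simp add: G_def W_sym \<psi>(2) F_odd)
  moreover have "G z \<noteq> 0" if "z \<in> K" for z
    using that K(2) \<psi>(3) F_nz by (auto simp: G_def)
  ultimately show thesis
    by (rule that)
qed

text \<open>Fixing the start of the motion at a base line turns a motion planner over \<open>U i\<close> into a family of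
paths as in the preceding lemma, over the set \<open>W i\<close> of all \<open>z\<close> for which the pair of the base line
and the line of \<open>z\<close> belongs to \<open>U i\<close>. The \<open>k\<close> resulting odd functions have no common zero, since
the compact sets \<open>K i\<close> cover the sphere.\<close>

theorem no_small_motion_planner_cover:
  assumes dim: "n < DIM('a::euclidean_space)" and k: "k \<le> n"
  shows "\<not> has_motion_planner_cover (real_projective_space n) k"
proof
  let ?S = "topspace (nsphere n)" and ?RP = "real_projective_space n"
  assume "has_motion_planner_cover ?RP k"
  then obtain U where U: "\<forall>i\<in>{1..k}. openin (prod_topology ?RP ?RP) (U i)"
    and U_cover: "(\<Union>i\<in>{1..k}. U i) = topspace (prod_topology ?RP ?RP)"
    and U_sections: "\<forall>i\<in>{1..k}. \<exists>s. continuous_map (subtopology (prod_topology ?RP ?RP) (U i)) (path_space ?RP) s \<and>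
                          (\<forall>p\<in>U i. path_endpoints (s p) = p)"
    unfolding has_motion_planner_cover_def by (elim exE conjE) (rule that; assumption)
  have U_open: "openin (prod_topology ?RP ?RP) (U i)" if "i \<in> {1..k}" for i
    using U that by (rule bspec)
  obtain s where s_all: "\<forall>i\<in>{1..k}. continuous_map (subtopology (prod_topology ?RP ?RP) (U i)) (path_space ?RP) (s i) \<and>
                          (\<forall>p\<in>U i. path_endpoints (s i p) = p)"
    using bchoice[OF U_sections] by (rule exE)
  have s: "continuous_map (subtopology (prod_topology ?RP ?RP) (U i)) (path_space ?RP) (s i)"
    if "i \<in> {1..k}" for i
    using bspec[OF s_all that] by (rule conjunct1)
  have s_ends: "s i p 0 = fst p \<and> s i p 1 = snd p" if "i \<in> {1..k}" "p \<in> U i" for i p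
  proof -
    have "path_endpoints (s i p) = p"
      using bspec[OF s_all that(1)] that(2) by blast
    then show ?thesis
      by (metis path_endpoints_def fst_conv snd_conv)
  qed
  define e :: "nat \<Rightarrow> real" where "e = (\<lambda>i. if i = 0 then 1 else 0)"
  have e: "e \<in> ?S"
    unfolding e_def by (rule in_topspace_nsphere)
  define \<iota> where "\<iota> = (\<lambda>z. (antipodal_pair e, antipodal_pair z))"
  have \<iota>: "continuous_map (nsphere n) (prod_topology ?RP ?RP) \<iota>"
    unfolding \<iota>_def
    by (intro continuous_map_pairedI continuous_map_antipodal_pair continuous_map_const[THEN iffD2])
       (use e in \<open>auto simp: topspace_real_projective_space\<close>)
  have \<iota>_sym: "\<iota> (antipode z) = \<iota> z" for z
    by (simp add: \<iota>_def)
  define W where "W = (\<lambda>i. {z \<in> ?S. \<iota> z \<in> U i})"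
  have W_open: "openin (nsphere n) (W i)" if "i \<in> {1..k}" for i
    unfolding W_def by (rule openin_continuous_map_preimage[OF \<iota> U_open[OF that]])
  have W_sym: "antipode z \<in> W i \<longleftrightarrow> z \<in> W i" for z i
    by (simp add: W_def \<iota>_sym)
  have W_cover: "\<exists>i\<in>{1..k}. z \<in> W i" if "z \<in> ?S" for z
  proof -
    have "\<iota> z \<in> topspace (prod_topology ?RP ?RP)"
      using \<iota> that by (auto simp: continuous_map_def)
    then show ?thesis
      using U_cover that by (auto simp: W_def)
  qed
  (* The distance d i from the complement of W i measures how deep a point lies inside W i. The
     origin, which is not on the sphere, is added because the distance from the empty set is 0 by
     convention, and it is fixed by the antipodal map. *)
  define C where "C = (\<lambda>i. insert (\<lambda>_. 0) (?S - W i))"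
  define d where "d = (\<lambda>i z. infdist z (C i))"
  have zero: "(\<lambda>_. 0) \<notin> ?S"
    by (simp add: mem_nsphere_iff)
  have C_closed: "closed (C i)" if "i \<in> {1..k}" for i
  proof -
    have "openin (top_of_set ?S) (W i)"
      using W_open[OF that] by (metis nsphere_eq_top_of_set)
    then have "closedin (top_of_set ?S) (?S - W i)"
      by (metis closedin_def closedin_diff closedin_topspace topspace_euclidean_subtopology)
    then have "closed (?S - W i)"
      using compact_imp_closed[OF compact_nsphere] by (rule closedin_closed_trans)
    then show ?thesis
      unfolding C_def by (rule closed_insert)
  qed
  have d_sym: "d i (antipode z) = d i z" for i z
    unfolding d_def
  proof (rule infdist_antipode)
    fix x :: "nat \<Rightarrow> real"
    have "antipode x = (\<lambda>_. 0) \<longleftrightarrow> x = (\<lambda>_. 0)"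
      by (auto simp: fun_eq_iff)
    then show "antipode x \<in> C i \<longleftrightarrow> x \<in> C i"
      by (simp add: C_def W_sym)
  qed
  have d_cont: "continuous_on A (d i)" for A i
    unfolding d_def by (intro continuous_intros)
  have d_pos: "d i z > 0 \<longleftrightarrow> z \<in> W i" if "i \<in> {1..k}" "z \<in> ?S" for i z
  proof -
    have "d i z = 0 \<longleftrightarrow> z \<in> C i"
      unfolding d_def using in_closed_iff_infdist_zero[OF C_closed[OF that(1)]] by (auto simp: C_def)
    moreover have "d i z \<ge> 0"
      by (simp add: d_def infdist_nonneg)
    moreover have "z \<in> C i \<longleftrightarrow> z \<notin> W i"
      using that(2) zero by (auto simp: C_def)
    ultimately show ?thesis
      by linarith
  qed
  (* A Lebesgue number of the cover: the sum of the distances is bounded below by compactness. *)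
  obtain \<delta> where \<delta>: "\<delta> > 0" and \<delta>_cover: "\<And>z. z \<in> ?S \<Longrightarrow> \<exists>i\<in>{1..k}. d i z \<ge> \<delta>"
  proof -
    have "\<exists>z0\<in>?S. \<forall>z\<in>?S. (\<Sum>i\<in>{1..k}. d i z0) \<le> (\<Sum>i\<in>{1..k}. d i z)"
      by (rule continuous_attains_inf[OF compact_nsphere])
         (use e d_cont in \<open>auto intro!: continuous_intros\<close>)
    then obtain z0 where z0: "z0 \<in> ?S"
      and min: "\<And>z. z \<in> ?S \<Longrightarrow> (\<Sum>i\<in>{1..k}. d i z0) \<le> (\<Sum>i\<in>{1..k}. d i z)"
      by blast
    obtain i0 where i0: "i0 \<in> {1..k}" "z0 \<in> W i0"
      using W_cover[OF z0] by blast
    have pos: "(\<Sum>i\<in>{1..k}. d i z0) > 0"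
      by (rule sum_pos2[OF _ i0(1)]) (use i0 z0 d_pos in \<open>auto simp: d_def infdist_nonneg\<close>)
    have k0: "k > 0"
      using i0 by auto
    show thesis
    proof
      show "(\<Sum>i\<in>{1..k}. d i z0) / k > 0"
        using pos k0 by simp
      fix z assume z: "z \<in> ?S"
      show "\<exists>i\<in>{1..k}. d i z \<ge> (\<Sum>i\<in>{1..k}. d i z0) / k"
      proof (rule ccontr)
        assume "\<not> ?thesis"
        then have "(\<Sum>i\<in>{1..k}. d i z) < (\<Sum>i\<in>{1..k}. (\<Sum>i\<in>{1..k}. d i z0) / k)"
          using i0 by (intro sum_strict_mono) (auto simp: not_le)
        with min[OF z] k0 show False
          by simp
      qed
    qed
  qed
  define K where "K = (\<lambda>i. {z \<in> ?S. d i z \<ge> \<delta>})"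
  have "\<exists>G. continuous_map (nsphere n) euclideanreal G \<and> (\<forall>z. G (antipode z) = - G z) \<and>
            (\<forall>z\<in>K i. G z \<noteq> 0)" if i: "i \<in> {1..k}" for i
  proof -
    let ?\<psi> = "\<lambda>z. max 0 (d i z - \<delta> / 2)"
    let ?V = "{z \<in> ?S. d i z < \<delta> / 2}"
    have d_map: "continuous_map (nsphere n) euclideanreal (d i)"
      by (subst nsphere_eq_top_of_set) (simp add: d_cont)
    have K_eq: "K i = ?S \<inter> {z. d i z \<ge> \<delta>}"
      by (auto simp: K_def)
    have K_comp: "compact (K i)"
      unfolding K_eq
      by (intro compact_Int_closed compact_nsphere closed_Collect_le continuous_on_const d_cont)
    have K_sub: "K i \<subseteq> W i"
      using d_pos[OF i] \<delta> by (force simp: K_def)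
    have V_open: "openin (nsphere n) ?V"
      using openin_continuous_map_preimage[OF d_map, of "{..<\<delta> / 2}"] by simp
    have V_cover: "?V \<union> W i = ?S"
    proof -
      have "z \<in> W i" if "z \<in> ?S" "\<not> d i z < \<delta> / 2" for z
        using d_pos[OF i that(1)] that(2) \<delta> by auto
      then show ?thesis
        by (auto simp: W_def)
    qed
    have \<iota>W: "continuous_map (subtopology (nsphere n) (W i)) (subtopology (prod_topology ?RP ?RP) (U i)) \<iota>"
      using \<iota> by (auto simp: continuous_map_in_subtopology continuous_map_from_subtopology W_def)
    have H: "continuous_map (prod_topology (subtopology (nsphere n) (W i)) (top_of_set {0..1})) ?RP
           (\<lambda>(z, t). s i (\<iota> z) t)"
      using continuous_map_path_space_eval[OF continuous_map_compose[OF \<iota>W s[OF i]]] by (simp add: o_def)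
    have ends: "s i (\<iota> z) 0 = antipodal_pair (\<lambda>i. if i = 0 then 1 else 0)"
      "s i (\<iota> z) 1 = antipodal_pair z" if "z \<in> W i" for z
      using s_ends[OF i, of "\<iota> z"] that by (auto simp: W_def \<iota>_def e_def)
    have \<psi>_cont: "continuous_on ?S ?\<psi>"
      by (intro continuous_intros d_cont)
    obtain G where "continuous_map (nsphere n) euclideanreal G"
      "\<And>z. G (antipode z) = - G z" "\<And>z. z \<in> K i \<Longrightarrow> G z \<noteq> 0"
      by (rule odd_function_of_local_section[OF W_open[OF i] W_sym K_comp K_sub \<psi>_cont _ _ V_open V_cover _ H])
         (use \<delta> ends in \<open>auto simp: d_sym \<iota>_sym K_def\<close>)
    then show ?thesis
      by blast
  qed
  then obtain G where G: "\<And>i. i \<in> {1..k} \<Longrightarrow> continuous_map (nsphere n) euclideanreal (G i)"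
    and G_odd: "\<And>i z. i \<in> {1..k} \<Longrightarrow> G i (antipode z) = - G i z"
    and G_nz: "\<And>i z. \<lbrakk>i \<in> {1..k}; z \<in> K i\<rbrakk> \<Longrightarrow> G i z \<noteq> 0"
    by metis
  define F where "F = (\<lambda>j z. if j < k then G (Suc j) z else 0)"
  have "\<exists>z\<in>?S. \<forall>j<n. F j z = 0"
  proof (rule Borsuk_Ulam_nonvanishing[OF dim])
    show "continuous_map (nsphere n) euclideanreal (F j)" for j
      using G[of "Suc j"] by (cases "j < k") (auto simp: F_def)
    show "F j (antipode z) = - F j z" for j z
      using G_odd[of "Suc j"] by (auto simp: F_def)
  qed
  then obtain z where z: "z \<in> ?S" "\<And>j. j < n \<Longrightarrow> F j z = 0"
    by blast
  obtain i where i: "i \<in> {1..k}" "d i z \<ge> \<delta>"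
    using \<delta>_cover[OF z(1)] by blast
  then have "F (i - 1) z \<noteq> 0"
    using G_nz[OF i(1), of z] z(1) by (auto simp: F_def K_def)
  moreover have "i - 1 < n"
    using i(1) k by auto
  ultimately show False
    using z(2) by blast
qed

section \<open>The upper bound\<close>

text \<open>Row \<open>i\<close> is a signed permutation of the coordinates of \<open>x\<close>, namely the product of \<open>x\<close> with the
\<open>i\<close>-th basic octonion for one of the usual sign conventions. Row \<open>0\<close> is \<open>x\<close> and the other
rows are orthogonal to \<open>x\<close>. Degen's eight-square identity, proved below, says that the rows form
an orthogonal basis if \<open>x\<close> is nonzero.\<close>

definition octonion_frame :: "nat \<Rightarrow> (nat \<Rightarrow> real) \<Rightarrow> nat \<Rightarrow> real" where
  "octonion_frame i x j = (if i < 8 \<and> j < 8 then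
     [[  x 0,   x 1,   x 2,   x 3,   x 4,   x 5,   x 6,   x 7],
      [- x 1,   x 0,   x 3, - x 2,   x 5, - x 4, - x 7,   x 6],
      [- x 2, - x 3,   x 0,   x 1,   x 6,   x 7, - x 4, - x 5],
      [- x 3,   x 2, - x 1,   x 0,   x 7, - x 6,   x 5, - x 4],
      [- x 4, - x 5, - x 6, - x 7,   x 0,   x 1,   x 2,   x 3],
      [- x 5,   x 4, - x 7,   x 6, - x 1,   x 0, - x 3,   x 2],
      [- x 6,   x 7,   x 4, - x 5, - x 2,   x 3,   x 0, - x 1],
      [- x 7, - x 6,   x 5,   x 4, - x 3, - x 2,   x 1,   x 0]] ! i ! j else 0)"

lemma lessThan_8: "{..<8::nat} = {0,1,2,3,4,5,6,7}"
  by auto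

lemma octonion_frame_orthogonal:
  "(\<Sum>j<8. octonion_frame i x j * x j) = (if i = 0 then \<Sum>j<8. (x j)\<^sup>2 else 0)"
proof (cases "i < 8")
  case True
  then have "i \<in> {0,1,2,3,4,5,6,7}"
    by auto
  then show ?thesis
    by (auto simp: octonion_frame_def lessThan_8 power2_eq_square)
qed (simp add: octonion_frame_def)

lemma octonion_frame_identity:
  "(\<Sum>i<8. (\<Sum>j<8. octonion_frame i x j * y j)\<^sup>2) = (\<Sum>j<8. (x j)\<^sup>2) * (\<Sum>j<8. (y j)\<^sup>2)"
  by (simp add: octonion_frame_def lessThan_8) (simp add: power2_eq_square algebra_simps)

text \<open>The position of the coordinate used in row \<open>i\<close> and column \<open>j\<close> is the bitwise exclusive or of \<open>i\<close> and
\<open>j\<close>. Therefore the complex numbers and the quaternions, given by the index bounds \<open>n = 1\<close> and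
\<open>n = 3\<close>, are closed under the construction.\<close>

lemma octonion_frame_subalgebra:
  assumes "n \<in> {1, 3, 7}" and x: "\<And>j. j > n \<Longrightarrow> x j = 0" and ij: "i > n" "j \<le> n"
  shows "octonion_frame i x j = 0"
proof (cases "i < 8 \<and> j < 8")
  case True
  then have "i \<in> {0,1,2,3,4,5,6,7}" "j \<in> {0,1,2,3,4,5,6,7}"
    by auto
  then show ?thesis
    using assms(1) ij by (auto simp: octonion_frame_def x)
qed (auto simp: octonion_frame_def)

lemma octonion_frame_nsphere:
  assumes n: "n \<in> {1, 3, 7}" and x: "x \<in> topspace (nsphere n)" and y: "y \<in> topspace (nsphere n)"
  shows "i \<le> n \<Longrightarrow> (\<Sum>j\<le>n. octonion_frame i x j * x j) = (if i = 0 then 1 else 0)"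
    and "\<exists>i<n + 1. (\<Sum>j\<le>n. octonion_frame i x j * y j) \<noteq> 0"
proof -
  have x0: "x j = 0" "y j = 0" if "j > n" for j
    using x y that by (auto simp: mem_nsphere_iff)
  have sum8: "(\<Sum>j<8. h j) = (\<Sum>j\<le>n. h j)" if "\<And>j. j > n \<Longrightarrow> h j = 0" for h :: "nat \<Rightarrow> real"
    by (rule sum.mono_neutral_right) (use n that in \<open>auto simp: not_le\<close>)
  have x1: "(\<Sum>j<8. (x j)\<^sup>2) = 1" "(\<Sum>j<8. (y j)\<^sup>2) = 1"
    using x y by (simp_all add: sum8 x0 mem_nsphere_iff)
  show "(\<Sum>j\<le>n. octonion_frame i x j * x j) = (if i = 0 then 1 else 0)" if "i \<le> n"
    using octonion_frame_orthogonal[of i x] by (simp add: sum8 x0 x1(1)[unfolded sum8])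
  have "(\<Sum>i<8. (\<Sum>j<8. octonion_frame i x j * y j)\<^sup>2) = 1"
    unfolding octonion_frame_identity x1 by simp
  moreover have "(\<Sum>j<8. octonion_frame i x j * y j) = (\<Sum>j\<le>n. octonion_frame i x j * y j)" for i
    by (rule sum8) (simp add: x0)
  moreover have "(\<Sum>j\<le>n. octonion_frame i x j * y j) = 0" if "i > n" for i
    using octonion_frame_subalgebra[OF n x0(1) that] by (intro sum.neutral) auto
  ultimately have "(\<Sum>i\<le>n. (\<Sum>j\<le>n. octonion_frame i x j * y j)\<^sup>2) = 1"
    by (simp add: sum8)
  then show "\<exists>i<n + 1. (\<Sum>j\<le>n. octonion_frame i x j * y j) \<noteq> 0"
    by (metis (no_types, lifting) atMost_iff less_Suc_eq_le Suc_eq_plus1 sum.neutral zero_neq_one zero_power2)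
qed

definition pair_of_lines :: "(nat \<Rightarrow> real) \<times> (nat \<Rightarrow> real) \<Rightarrow> (nat \<Rightarrow> real) set \<times> (nat \<Rightarrow> real) set" where
  "pair_of_lines z = (antipodal_pair (fst z), antipodal_pair (snd z))"

lemma continuous_map_pair_of_lines:
  "continuous_map (prod_topology (nsphere n) (nsphere n))
     (prod_topology (real_projective_space n) (real_projective_space n)) pair_of_lines"
  unfolding pair_of_lines_def
  by (intro continuous_map_pairedI continuous_map_compose[OF continuous_map_fst continuous_map_antipodal_pair, unfolded o_def]
      continuous_map_compose[OF continuous_map_snd continuous_map_antipodal_pair, unfolded o_def])

lemma pair_of_lines_image:
  "pair_of_lines ` topspace (prod_topology (nsphere n) (nsphere n)) =
     topspace (prod_topology (real_projective_space n) (real_projective_space n))"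
  by (auto simp: pair_of_lines_def topspace_real_projective_space image_iff Bex_def) blast

lemma open_map_pair_of_lines:
  "open_map (prod_topology (nsphere n) (nsphere n))
     (prod_topology (real_projective_space n) (real_projective_space n)) pair_of_lines"
  unfolding open_map_def openin_prod_topology_alt[of "real_projective_space n"]
proof (intro allI impI)
  fix O' L M assume O: "openin (prod_topology (nsphere n) (nsphere n)) O'" and "(L, M) \<in> pair_of_lines ` O'"
  then obtain x y where xy: "(x, y) \<in> O'" "L = antipodal_pair x" "M = antipodal_pair y"
    by (auto simp: pair_of_lines_def)
  then obtain A B where AB: "openin (nsphere n) A" "openin (nsphere n) B" "x \<in> A" "y \<in> B" "A \<times> B \<subseteq> O'"
    using O by (metis openin_prod_topology_alt)
  have "antipodal_pair ` A \<times> antipodal_pair ` B \<subseteq> pair_of_lines ` O'"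
    using AB(5) by (auto simp: pair_of_lines_def image_iff) (metis SigmaI fst_conv snd_conv subsetD)
  then show "\<exists>U V. openin (real_projective_space n) U \<and> openin (real_projective_space n) V \<and>
      L \<in> U \<and> M \<in> V \<and> U \<times> V \<subseteq> pair_of_lines ` O'"
    using AB xy open_map_antipodal_pair[of n]
    by (intro exI[of _ "antipodal_pair ` A"] exI[of _ "antipodal_pair ` B"]) (auto simp: open_map_def)
qed

lemma pair_of_lines_eq_iff:
  "pair_of_lines (x, y) = pair_of_lines (x', y') \<longleftrightarrow>
     (x = x' \<or> x = antipode x') \<and> (y = y' \<or> y = antipode y')"
  by (simp add: pair_of_lines_def antipodal_pair_eq_iff)

text \<open>Let \<open>B i\<close> consist of the pairs \<open>(x, y)\<close> for which \<open>c = \<langle>A i x, y\<rangle>\<close> is nonzero. The curve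
\<open>(1 - t) x + t (1 - t) A i x + t c y\<close> runs from \<open>x\<close> to a nonzero multiple of \<open>y\<close>. It avoids the origin:
its inner product with \<open>A i x\<close> is at least \<open>t c\<^sup>2\<close>, which is positive for \<open>t > 0\<close>. Replacing \<open>x\<close> by \<open>- x\<close>
changes the sign of \<open>A i x\<close> and of \<open>c\<close>, hence of the whole curve, while replacing \<open>y\<close> by \<open>- y\<close> leaves
the curve unchanged because of the factor \<open>c\<close>. The curve of lines therefore depends on the two
lines only, and it is continuous in them because passing from points to lines is an open map.\<close>

lemma motion_planner_cover_of_vector_fields:
  fixes A :: "nat \<Rightarrow> (nat \<Rightarrow> real) \<Rightarrow> nat \<Rightarrow> real"
  assumes cont: "\<And>i j. \<lbrakk>i < k; j \<le> n\<rbrakk> \<Longrightarrow> continuous_map (nsphere n) euclideanreal (\<lambda>x. A i x j)"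
    and A_odd: "\<And>i x. i < k \<Longrightarrow> A i (antipode x) = antipode (A i x)"
    and nonneg: "\<And>i x. \<lbrakk>i < k; x \<in> topspace (nsphere n)\<rbrakk> \<Longrightarrow> (\<Sum>j\<le>n. A i x j * x j) \<ge> 0"
    and span: "\<And>x y. \<lbrakk>x \<in> topspace (nsphere n); y \<in> topspace (nsphere n)\<rbrakk> \<Longrightarrow>
                 \<exists>i<k. (\<Sum>j\<le>n. A i x j * y j) \<noteq> 0"
  shows "has_motion_planner_cover (real_projective_space n) k"
proof -
  let ?S = "nsphere n" and ?RP = "real_projective_space n" and ?I = "top_of_set {0..1::real}"
  let ?SS = "prod_topology ?S ?S" and ?PP = "prod_topology ?RP ?RP"
  define ip where "ip = (\<lambda>i x y. \<Sum>j\<le>n. A i x j * y j)"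
  define B where "B = (\<lambda>i. {z \<in> topspace ?SS. ip i (fst z) (snd z) \<noteq> 0})"
  have ip_neg: "ip i (antipode x) y = - ip i x y" "ip i x (antipode y) = - ip i x y" if "i < k" for i x y
    using that by (simp_all add: ip_def A_odd sum_negf)
  have coord: "continuous_map ?SS euclideanreal (\<lambda>z. fst z j)" "continuous_map ?SS euclideanreal (\<lambda>z. snd z j)" for j
    using continuous_map_compose[OF continuous_map_fst continuous_map_nsphere_projection]
      continuous_map_compose[OF continuous_map_snd continuous_map_nsphere_projection]
    by (auto simp: o_def)
  have contA: "continuous_map ?SS euclideanreal (\<lambda>z. A i (fst z) j)" if "i < k" "j \<le> n" for i j
    using continuous_map_compose[OF continuous_map_fst cont[OF that]] by (simp add: o_def)
  have cont_ip: "continuous_map ?SS euclideanreal (\<lambda>z. ip i (fst z) (snd z))" if "i < k" for i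
    unfolding ip_def using that
    by (intro continuous_map_sum continuous_map_real_mult contA coord) auto
  have B_open: "openin ?SS (B i)" if "i < k" for i
    using openin_continuous_map_preimage[OF cont_ip[OF that], of "- {0}"] by (auto simp: B_def)
  have B_sat: "{z \<in> topspace ?SS. pair_of_lines z \<in> pair_of_lines ` B i} = B i" if "i < k" for i
  proof -
    have "(x, y) \<in> B i"
      if "(x, y) \<in> topspace ?SS" "pair_of_lines (x, y) = pair_of_lines (x', y')" "(x', y') \<in> B i" for x y x' y'
      using that \<open>i < k\<close> ip_neg[OF \<open>i < k\<close>] unfolding pair_of_lines_eq_iff B_def by auto
    then show ?thesis
      by (auto simp: B_def)
  qed
  (* Vector fields are numbered from 0, members of the cover from 1. *)
  define U where "U = (\<lambda>i. pair_of_lines ` B (i - 1))"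
  have U_open: "openin ?PP (U i)" if "i \<in> {1..k}" for i
    using open_map_pair_of_lines[of n] B_open[of "i - 1"] that by (auto simp: open_map_def U_def)
  have U_cover: "(\<Union>i\<in>{1..k}. U i) = topspace ?PP"
  proof
    show "(\<Union>i\<in>{1..k}. U i) \<subseteq> topspace ?PP"
      using U_open openin_subset by blast
    show "topspace ?PP \<subseteq> (\<Union>i\<in>{1..k}. U i)"
    proof
      fix p assume "p \<in> topspace ?PP"
      then obtain z where z: "z \<in> topspace ?SS" "p = pair_of_lines z"
        unfolding pair_of_lines_image[symmetric] by blast
      then obtain i where "i < k" "z \<in> B i"
        using span[of "fst z" "snd z"] by (auto simp: B_def ip_def)
      then show "p \<in> (\<Union>i\<in>{1..k}. U i)"
        using z by (intro UN_I[of "Suc i"]) (auto simp: U_def)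
    qed
  qed
  have "\<exists>s. continuous_map (subtopology ?PP (U i)) (path_space ?RP) s \<and> (\<forall>p\<in>U i. path_endpoints (s p) = p)"
    if "i \<in> {1..k}" for i
  proof -
    define m where "m = i - 1"
    have m: "m < k" and Um: "U i = pair_of_lines ` B m"
      using that by (auto simp: m_def U_def)
    have U_openm: "openin ?PP (pair_of_lines ` B m)"
      using U_open[OF that] Um by simp
    define g where "g = (\<lambda>(z, t) j. (1 - t) * fst z j + t * (1 - t) * A m (fst z) j + t * ip m (fst z) (snd z) * snd z j)"
    define h where "h = (\<lambda>w. antipodal_pair (normalize_to_sphere n (g w)))"
    let ?X = "prod_topology (subtopology ?SS (B m)) ?I"
    let ?Y = "prod_topology (subtopology ?PP (pair_of_lines ` B m)) ?I"
    have g_nz: "\<exists>j\<le>n. g ((x, y), t) j \<noteq> 0" if "(x, y) \<in> B m" "t \<in> {0..1}" for x y t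
    proof (cases "t = 0")
      case True
      have "x \<in> topspace ?S"
        using that by (auto simp: B_def)
      then have "\<exists>j\<le>n. x j \<noteq> 0"
        by (metis (no_types, lifting) atMost_iff mem_nsphere_iff sum.neutral zero_neq_one zero_power2)
      then show ?thesis
        using True by (simp add: g_def)
    next
      case False
      have x: "x \<in> topspace ?S" and c: "ip m x y \<noteq> 0"
        using that by (auto simp: B_def)
      have "(\<Sum>j\<le>n. A m x j * g ((x, y), t) j) =
          (1 - t) * (\<Sum>j\<le>n. A m x j * x j) + t * (1 - t) * (\<Sum>j\<le>n. (A m x j)\<^sup>2) + t * ip m x y * ip m x y"
      proof -
        have "(\<Sum>j\<le>n. A m x j * g ((x, y), t) j) =
            (\<Sum>j\<le>n. (1 - t) * (A m x j * x j) + t * (1 - t) * (A m x j)\<^sup>2 + t * ip m x y * (A m x j * y j))"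
          by (rule sum.cong) (auto simp: g_def algebra_simps power2_eq_square)
        also have "\<dots> = (1 - t) * (\<Sum>j\<le>n. A m x j * x j) + t * (1 - t) * (\<Sum>j\<le>n. (A m x j)\<^sup>2)
            + t * ip m x y * (\<Sum>j\<le>n. A m x j * y j)"
          by (simp only: sum.distrib sum_distrib_left)
        finally show ?thesis
          by (simp add: ip_def)
      qed
      moreover have "(1 - t) * (\<Sum>j\<le>n. A m x j * x j) \<ge> 0" "t * (1 - t) * (\<Sum>j\<le>n. (A m x j)\<^sup>2) \<ge> 0"
        using that nonneg[OF m x] by (auto intro!: mult_nonneg_nonneg sum_nonneg)
      moreover have "t * ip m x y * ip m x y > 0"
        using False that c by (auto simp: mult.assoc zero_less_mult_iff linorder_neq_iff)
      ultimately have "(\<Sum>j\<le>n. A m x j * g ((x, y), t) j) > 0"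
        by linarith
      then show ?thesis
        by (metis (no_types, lifting) atMost_iff less_irrefl mult_zero_right sum.neutral)
    qed
    have fstX: "continuous_map ?X ?SS fst"
      by (metis continuous_map_fst continuous_map_into_fulltopology)
    have sndX: "continuous_map ?X euclideanreal snd"
      by (metis continuous_map_snd continuous_map_into_fulltopology)
    have contg: "continuous_map ?X euclideanreal (\<lambda>w. g w j)" if "j \<le> n" for j
    proof -
      note c = continuous_map_compose[OF fstX, unfolded o_def]
      show ?thesis
        unfolding g_def case_prod_unfold
        by (intro continuous_map_add continuous_map_real_mult continuous_map_diff sndX
            c[OF coord(1)] c[OF coord(2)] c[OF contA[OF m that]] c[OF cont_ip[OF m]])
          auto
    qed
    have conth: "continuous_map ?X ?RP h"
      unfolding h_def
    proof (rule continuous_map_compose[OF _ continuous_map_antipodal_pair, unfolded o_def])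
      show "continuous_map ?X ?S (\<lambda>w. normalize_to_sphere n (g w))"
        using contg g_nz by (intro continuous_map_normalize_to_sphere) auto
    qed
    have quot: "quotient_map ?X ?Y (\<lambda>(z, t). (pair_of_lines z, t))"
    proof (rule quotient_map_prod_left)
      have "quotient_map ?SS ?PP pair_of_lines"
        by (intro continuous_open_imp_quotient_map continuous_map_pair_of_lines open_map_pair_of_lines pair_of_lines_image)
      then show "quotient_map (subtopology ?SS (B m)) (subtopology ?PP (pair_of_lines ` B m)) pair_of_lines"
        by (rule quotient_map_restriction) (use B_sat[OF m] U_openm in auto)
      show "locally_compact_space ?I"
        by (intro compact_imp_locally_compact_space) (auto simp: compact_space_subtopology)
      show "Hausdorff_space ?I \<or> regular_space ?I"
        by (simp add: Hausdorff_space_subtopology)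
    qed
    obtain G where G: "continuous_map ?Y ?RP G"
      and Gh: "\<And>w. w \<in> topspace ?X \<Longrightarrow> G ((\<lambda>(z, t). (pair_of_lines z, t)) w) = h w"
    proof (rule quotient_map_lift_exists[OF quot conth])
      fix w w' assume w: "w \<in> topspace ?X" "w' \<in> topspace ?X"
        and eq: "(\<lambda>(z, t). (pair_of_lines z, t)) w = (\<lambda>(z, t). (pair_of_lines z, t)) w'"
      obtain x y t where w_eq: "w = ((x, y), t)"
        by (metis surj_pair)
      obtain x' y' where w'_eq: "w' = ((x', y'), t)"
        using eq w_eq by (cases w') auto
      have g_x: "g ((antipode x', v), t) = antipode (g ((x', v), t))"
        and g_y: "g ((v, antipode y'), t) = g ((v, y'), t)" for v
        by (simp_all add: g_def fun_eq_iff ip_neg[OF m] A_odd[OF m] algebra_simps)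
      have "(x = x' \<or> x = antipode x') \<and> (y = y' \<or> y = antipode y')"
        using eq by (simp add: w_eq w'_eq pair_of_lines_eq_iff)
      then have "g w = g w' \<or> g w = antipode (g w')"
        unfolding w_eq w'_eq using g_x g_y by metis
      then show "h w = h w'"
        by (auto simp: h_def normalize_to_sphere_antipode)
    qed (rule that; assumption)
    have h0: "h ((x, y), 0) = antipodal_pair x" and h1: "h ((x, y), 1) = antipodal_pair y"
      if "(x, y) \<in> B m" for x y
    proof -
      have mem: "x \<in> topspace ?S" "y \<in> topspace ?S" and c: "ip m x y \<noteq> 0"
        using that by (auto simp: B_def)
      show "h ((x, y), 0) = antipodal_pair x"
        using mem by (simp add: h_def g_def normalize_to_sphere_id)
      have "h ((x, y), 1) = antipodal_pair (normalize_to_sphere n (\<lambda>j. ip m x y * y j))"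
        by (simp add: h_def g_def)
      also have "\<dots> = antipodal_pair y"
      proof (cases "ip m x y > 0")
        case True
        then show ?thesis
          using mem by (simp add: normalize_to_sphere_scale normalize_to_sphere_id)
      next
        case False
        have "(\<lambda>j. ip m x y * y j) = (\<lambda>j. (- ip m x y) * antipode y j)"
          by simp
        moreover have "normalize_to_sphere n (\<lambda>j. (- ip m x y) * antipode y j) = antipode y"
          using False c mem by (subst normalize_to_sphere_scale) (auto simp: normalize_to_sphere_id)
        ultimately show ?thesis
          by (metis antipodal_pair_antipode)
      qed
      finally show "h ((x, y), 1) = antipodal_pair y" .
    qed
    let ?s = "\<lambda>p. restrict (\<lambda>t. G (p, t)) {0..1}"
    have "continuous_map (subtopology ?PP (U i)) (path_space ?RP) ?s"
      unfolding Um by (rule continuous_map_path_space_curry[OF G])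
    moreover have "path_endpoints (?s p) = p" if p: "p \<in> U i" for p
    proof -
      obtain x y where xy: "(x, y) \<in> B m" "p = pair_of_lines (x, y)"
        using p unfolding Um by auto
      have "((x, y), t) \<in> topspace ?X" if "t \<in> {0..1}" for t
        using xy(1) that by (auto simp: B_def)
      then have "G (p, t) = h ((x, y), t)" if "t \<in> {0..1}" for t
        using Gh[of "((x, y), t)"] that xy(2) by simp
      then show ?thesis
        using h0[OF xy(1)] h1[OF xy(1)] by (simp add: path_endpoints_def xy(2) pair_of_lines_def)
    qed
    ultimately show ?thesis
      by blast
  qed
  then show ?thesis
    unfolding has_motion_planner_cover_def using U_open U_cover by (intro exI[of _ U]) blast
qed

lemma continuous_map_octonion_frame:
  "continuous_map (nsphere n) euclideanreal (\<lambda>x. octonion_frame i x j)"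
proof (cases "i < 8 \<and> j < 8")
  case True
  then have "i \<in> {0,1,2,3,4,5,6,7}" "j \<in> {0,1,2,3,4,5,6,7}"
    by auto
  then show ?thesis
    unfolding octonion_frame_def
    by (elim insertE emptyE)
       (simp_all add: continuous_map_nsphere_projection continuous_map_minus)
next
  case False
  then have "(\<lambda>x. octonion_frame i x j) = (\<lambda>x. 0)"
    by (auto simp: octonion_frame_def)
  then show ?thesis
    by simp
qed

lemma octonion_frame_antipode: "octonion_frame i (antipode x) = antipode (octonion_frame i x)"
proof
  fix j
  show "octonion_frame i (antipode x) j = antipode (octonion_frame i x) j"
  proof (cases "i < 8 \<and> j < 8")
    case True
    then have "i \<in> {0,1,2,3,4,5,6,7}" "j \<in> {0,1,2,3,4,5,6,7}"
      by auto
    then show ?thesis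
      unfolding octonion_frame_def by (elim insertE emptyE) simp_all
  qed (auto simp: octonion_frame_def)
qed

text \<open>In these dimensions the sphere is parallelizable: the first \<open>n + 1\<close> rows of the octonion frame are
an orthonormal basis consisting of \<open>x\<close> and of \<open>n\<close> tangent vectors at \<open>x\<close>.\<close>

lemma has_motion_planner_cover_parallelizable:
  assumes n: "n \<in> {1, 3, 7}"
  shows "has_motion_planner_cover (real_projective_space n) (n + 1)"
proof (rule motion_planner_cover_of_vector_fields[where A = octonion_frame])
  show "\<exists>i<n + 1. (\<Sum>j\<le>n. octonion_frame i x j * y j) \<noteq> 0"
    if "x \<in> topspace (nsphere n)" "y \<in> topspace (nsphere n)" for x y
    using octonion_frame_nsphere(2)[OF n that] .
  show "(\<Sum>j\<le>n. octonion_frame i x j * x j) \<ge> 0"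
    if "i < n + 1" "x \<in> topspace (nsphere n)" for i x
    using octonion_frame_nsphere(1)[OF n that(2) that(2), of i] that(1) by simp
qed (simp_all add: continuous_map_octonion_frame octonion_frame_antipode)

section \<open>The topological complexity\<close>

theorem proposition18:
  fixes n :: nat
  assumes "n \<in> {1, 3, 7}"
  shows "topological_complexity (real_projective_space n) = enat (n + 1)"
  unfolding topological_complexity_eq_enat_iff
proof (intro conjI allI impI)
  show "has_motion_planner_cover (real_projective_space n) (n + 1)"
    using assms by (rule has_motion_planner_cover_parallelizable)
  have "n < DIM(real^8)"
    using assms by auto
  then show "\<not> has_motion_planner_cover (real_projective_space n) k" if "k < n + 1" for k
    by (rule no_small_motion_planner_cover) (use that in simp)
qed

end
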